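(* Let $p$ be a prime number. There exists a free, non-proper, non-Hamiltonian $p$-adic analytic symplectic Lie group action of (the additive group of) the field of $p$-adic numbers $\mathbb{Q}_p$ on $(\mathbb{Z}_p)^2$, the Cartesian product of the ring of $p$-adic integers with itself, endowed with the symplectic form $\mathrm{d}x\wedge\mathrm{d}y$.
   Context: A function between open subsets of $(\mathbb{Q}_p)^{d_1}$ and $(\mathbb{Q}_p)^{d_2}$ is $p$-adic analytic if its domain is a union of open sets on each of which it is given by a convergent power series. $(x,y)$ are the standard coordinates on $(\mathbb{Z}_p)^2$. Write $M=(\mathbb{Z}_p)^2$, $\omega=\mathrm{d}x\wedge\mathrm{d}y$, $G=\mathbb{Q}_p$ (a $1$-dimensional Abelian $p$-adic analytic Lie group with Lie algebra $\mathfrak{g}=\mathrm{T}_0\mathbb{Q}_p\cong\mathbb{Q}_p$). A $p$-adic analytic symplectic Lie group action is a group action $\psi:G\times M\to M$ which is a $p$-adic analytic map with $\psi(g,\cdot)^*\omega=\omega$ for every $g\in G$. It is free if the stabilizer of every point is trivial. It is proper if for all sequences $(m_i)_i$ in $M$ and $(g_i)_i$ in $G$ such that $(m_i)_i$ and $(\psi(g_i,m_i))_i$ both converge, the sequence $(g_i)_i$ contains a convergent subsequence. For $\xi\in\mathfrak{g}$ let $\mathrm{X}_\psi(\xi)(m)=\psi(\cdot,m)_*(\xi)$ (push-forward of $\xi$ by $g\mapsto\psi(g,m)$ at the identity). A $p$-adic analytic momentum map is a $p$-adic analytic map $\mu:M\to\mathfrak{g}^*$ with $\omega(\mathrm{X}_\psi(\xi),\cdot)=\mathrm{d}\mu_\xi$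 for each $\xi\in\mathfrak{g}$, where $\mu_\xi(m)=\langle\mu(m),\xi\rangle$. Since $G$ is Abelian, $\psi$ is Hamiltonian if there exists a $p$-adic analytic momentum map which is constant on each orbit. *)

theory Defs
  imports "HOL-Analysis.Analysis" "Berlekamp_Zassenhaus.Finite_Field"
begin

section \<open>The p-adic absolute value on the rationals\<close>

definition rat_pval :: "nat \<Rightarrow> rat \<Rightarrow> int" where
  "rat_pval p q = int (multiplicity (int p) (fst (quotient_of q)))
                - int (multiplicity (int p) (snd (quotient_of q)))"

definition rat_pabs :: "nat \<Rightarrow> rat \<Rightarrow> real" where
  "rat_pabs p q = (if q = 0 then 0 else real p powi (- rat_pval p q))"

lemma rat_pval_divide:
  assumes p: "prime p" and ab: "a \<noteq> 0" "b \<noteq> 0"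
  shows "rat_pval p (of_int a / of_int b) = int (multiplicity (int p) a) - int (multiplicity (int p) b)"
proof -
  define q where "q = (of_int a / of_int b :: rat)"
  define c where "c = fst (quotient_of q)"
  define d where "d = snd (quotient_of q)"
  have q: "quotient_of q = (c, d)" by (simp add: c_def d_def)
  have d: "d \<noteq> 0" using quotient_of_denom_pos[OF q] by simp
  have eq: "q = of_int c / of_int d" using quotient_of_div[OF q] .
  have "q \<noteq> 0" using ab by (simp add: q_def)
  hence c: "c \<noteq> 0" using eq by auto
  have "of_int a / of_int b = (of_int c / of_int d :: rat)" using eq q_def by simp
  hence "(of_int (a * d) :: rat) = of_int (c * b)"
    using ab d by (simp add: frac_eq_eq)
  hence cross: "a * d = c * b" by (simp only: of_int_eq_iff)
  have pe: "prime_elem (int p)" using p by simp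
  have "multiplicity (int p) a + multiplicity (int p) d = multiplicity (int p) c + multiplicity (int p) b"
    using arg_cong[OF cross, of "multiplicity (int p)"] ab c d
    by (simp add: prime_elem_multiplicity_mult_distrib[OF pe])
  thus ?thesis unfolding rat_pval_def q_def[symmetric] c_def[symmetric] d_def[symmetric] by linarith
qed

lemma rat_obtain:
  obtains a b where "b \<noteq> (0::int)" "(x::rat) = of_int a / of_int b"
proof -
  obtain a b where ab: "quotient_of x = (a, b)" by fastforce
  show thesis using quotient_of_denom_pos[OF ab] quotient_of_div[OF ab] by (intro that[of b a]) auto
qed

lemma rat_pabs_0 [simp]: "rat_pabs p 0 = 0"
  by (simp add: rat_pabs_def)

lemma rat_pabs_pos: "prime p \<Longrightarrow> x \<noteq> 0 \<Longrightarrow> rat_pabs p x > 0"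
  by (simp add: rat_pabs_def prime_gt_0_nat)

lemma rat_pabs_nonneg: "prime p \<Longrightarrow> rat_pabs p x \<ge> 0"
  using rat_pabs_pos[of p x] by (cases "x = 0") auto

lemma rat_pabs_mult:
  assumes p: "prime p" shows "rat_pabs p (x * y) = rat_pabs p x * rat_pabs p y"
proof (cases "x = 0 \<or> y = 0")
  case False
  obtain a b where ab: "b \<noteq> 0" "x = of_int a / of_int b" by (rule rat_obtain)
  obtain c d where cd: "d \<noteq> 0" "y = of_int c / of_int d" by (rule rat_obtain)
  have nz: "a \<noteq> 0" "c \<noteq> 0" using False ab cd by auto
  have pe: "prime_elem (int p)" using p by simp
  have "x * y = of_int (a * c) / of_int (b * d)" using ab cd by simp
  hence "rat_pval p (x * y) = rat_pval p x + rat_pval p y"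
    using rat_pval_divide[OF p, of "a * c" "b * d"] rat_pval_divide[OF p, of a b]
      rat_pval_divide[OF p, of c d] ab cd nz
    by (simp add: prime_elem_multiplicity_mult_distrib[OF pe])
  thus ?thesis using False p
    by (simp add: rat_pabs_def power_int_add[symmetric] prime_gt_0_nat)
qed auto

lemma rat_pabs_1 [simp]: "rat_pabs p 1 = 1"
  by (simp add: rat_pabs_def rat_pval_def rat_one_code)

lemma rat_pabs_minus [simp]: "rat_pabs p (- x) = rat_pabs p x"
proof -
  have "multiplicity (int p) (- a) = multiplicity (int p) a" for a
    by (simp add: multiplicity_def)
  thus ?thesis by (simp add: rat_pabs_def rat_pval_def rat_uminus_code case_prod_beta)
qed

lemma rat_pabs_minus_commute: "rat_pabs p (x - y) = rat_pabs p (y - x)"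
  using rat_pabs_minus[of p "x - y"] by simp

lemma rat_pabs_inverse:
  assumes "prime p" shows "rat_pabs p (inverse x) = inverse (rat_pabs p x)"
proof (cases "x = 0")
  case False
  have "rat_pabs p x * rat_pabs p (inverse x) = 1"
    using rat_pabs_mult[OF assms, of x "inverse x"] False assms by simp
  thus ?thesis by (simp add: inverse_unique)
qed auto

lemma rat_pabs_ultra:
  assumes p: "prime p" shows "rat_pabs p (x + y) \<le> max (rat_pabs p x) (rat_pabs p y)"
proof (cases "x = 0 \<or> y = 0 \<or> x + y = 0")
  case False
  obtain a b where ab: "b \<noteq> 0" "x = of_int a / of_int b" by (rule rat_obtain)
  obtain c d where cd: "d \<noteq> 0" "y = of_int c / of_int d" by (rule rat_obtain)
  define s where "s = a * d"
  define t where "t = c * b"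
  define e where "e = b * d"
  have e: "e \<noteq> 0" using ab cd by (simp add: e_def)
  have x: "x = of_int s / of_int e" and y: "y = of_int t / of_int e"
    using ab cd by (simp_all add: s_def t_def e_def)
  have xy: "x + y = of_int (s + t) / of_int e" by (simp add: x y add_divide_distrib)
  have nz: "s \<noteq> 0" "t \<noteq> 0" "s + t \<noteq> 0" using False x y xy by auto
  have nu: "\<not> is_unit (int p)" using prime_gt_1_nat[OF p] by simp
  define k where "k = min (multiplicity (int p) s) (multiplicity (int p) t)"
  have "int p ^ k dvd s" "int p ^ k dvd t"
    unfolding k_def by (auto intro: multiplicity_dvd')
  hence "int p ^ k dvd s + t" by simp
  hence "k \<le> multiplicity (int p) (s + t)"
    using nu nz by (intro multiplicity_geI) auto
  hence "min (rat_pval p x) (rat_pval p y) \<le> rat_pval p (x + y)"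
    using rat_pval_divide[OF p nz(1) e] rat_pval_divide[OF p nz(2) e] rat_pval_divide[OF p nz(3) e]
    unfolding x[symmetric] y[symmetric] xy[symmetric] k_def by linarith
  moreover have mono: "real p powi (- n) \<le> real p powi (- m)" if "m \<le> n" for m n
    using that p by (intro power_int_increasing) (auto simp: Suc_le_eq prime_gt_0_nat)
  ultimately have "rat_pabs p (x + y) \<le> rat_pabs p x \<or> rat_pabs p (x + y) \<le> rat_pabs p y"
    using False by (auto simp: rat_pabs_def min_le_iff_disj)
  thus ?thesis by auto
qed (auto simp: rat_pabs_nonneg[OF p] le_max_iff_disj add_eq_0_iff)

lemma rat_pabs_add: "prime p \<Longrightarrow> rat_pabs p (x + y) \<le> rat_pabs p x + rat_pabs p y"
  using rat_pabs_ultra[of p x y] rat_pabs_nonneg[of p x] rat_pabs_nonneg[of p y] by linarith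

lemma rat_pabs_diff_le: "prime p \<Longrightarrow> \<bar>rat_pabs p x - rat_pabs p y\<bar> \<le> rat_pabs p (x - y)"
  using rat_pabs_add[of p "x - y" y] rat_pabs_add[of p "y - x" x] rat_pabs_minus_commute[of p x y]
  by simp

section \<open>The field of p-adic numbers\<close>

text \<open>The field is the completion of the rationals for the p-adic absolute value: Cauchy sequences
  modulo null sequences. The prime is the cardinality of the phantom type argument, so a free
  type variable of class \<open>prime_card\<close> ranges over all primes.\<close>

definition padic_Cauchy :: "nat \<Rightarrow> (nat \<Rightarrow> rat) \<Rightarrow> bool" where
  "padic_Cauchy p X \<longleftrightarrow> (\<forall>e>0. \<exists>k. \<forall>m\<ge>k. \<forall>n\<ge>k. rat_pabs p (X m - X n) < e)"

definition padic_null :: "nat \<Rightarrow> (nat \<Rightarrow> rat) \<Rightarrow> bool" where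
  "padic_null p X \<longleftrightarrow> (\<lambda>n. rat_pabs p (X n)) \<longlonglongrightarrow> 0"

definition padic_rel :: "nat \<Rightarrow> ((nat \<Rightarrow> rat) \<times> (nat \<Rightarrow> rat)) set" where
  "padic_rel p = {(X, Y). padic_Cauchy p X \<and> padic_Cauchy p Y \<and> padic_null p (\<lambda>n. X n - Y n)}"

lemma padic_Cauchy_const [simp]: "padic_Cauchy p (\<lambda>n. c)"
  by (simp add: padic_Cauchy_def)

typedef (overloaded) ('p::prime_card) padic =
  "Collect (padic_Cauchy CARD('p)) // padic_rel CARD('p)"
  by (auto simp: quotient_def intro!: exI[of _ "\<lambda>n. 0"])

lemma padic_null_le:
  assumes "prime p" "padic_null p X" "eventually (\<lambda>n. rat_pabs p (Y n) \<le> C * rat_pabs p (X n)) sequentially"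
  shows "padic_null p Y"
  unfolding padic_null_def
proof (rule tendsto_sandwich[OF _ assms(3) tendsto_const])
  show "(\<lambda>n. C * rat_pabs p (X n)) \<longlonglongrightarrow> 0"
    using tendsto_mult_left[OF assms(2)[unfolded padic_null_def], of C] by simp
qed (use rat_pabs_nonneg[OF assms(1)] in auto)

lemma padic_null_add:
  assumes "prime p" "padic_null p X" "padic_null p Y" shows "padic_null p (\<lambda>n. X n + Y n)"
  unfolding padic_null_def
proof (rule tendsto_sandwich[OF _ _ tendsto_const])
  show "(\<lambda>n. rat_pabs p (X n) + rat_pabs p (Y n)) \<longlonglongrightarrow> 0"
    using tendsto_add[OF assms(2,3)[unfolded padic_null_def]] by simp
qed (use rat_pabs_nonneg[OF assms(1)] rat_pabs_add[OF assms(1)] in auto)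

lemma padic_null_minus: "padic_null p (\<lambda>n. - X n) = padic_null p X"
  by (simp add: padic_null_def)

lemma padic_null_swap: "padic_null p (\<lambda>n. X n - Y n) = padic_null p (\<lambda>n. Y n - X n)"
  using padic_null_minus[of p "\<lambda>n. X n - Y n"] by simp

lemma equiv_padic_rel:
  assumes p: "prime p" shows "equiv (Collect (padic_Cauchy p)) (padic_rel p)"
proof (rule equivI)
  show "padic_rel p \<subseteq> Collect (padic_Cauchy p) \<times> Collect (padic_Cauchy p)"
    by (auto simp: padic_rel_def)
  show "refl_on (Collect (padic_Cauchy p)) (padic_rel p)"
    by (auto simp: refl_on_def padic_rel_def padic_null_def)
  show "sym (padic_rel p)"
    unfolding sym_def padic_rel_def using padic_null_swap by blast
  show "trans (padic_rel p)"
  proof (rule transI)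
    fix X Y Z assume "(X, Y) \<in> padic_rel p" "(Y, Z) \<in> padic_rel p"
    thus "(X, Z) \<in> padic_rel p"
      using padic_null_add[OF p, of "\<lambda>n. X n - Y n" "\<lambda>n. Y n - Z n"] by (simp add: padic_rel_def)
  qed
qed

text \<open>\<open>padic_of\<close> sends a Cauchy sequence to its class, and \<open>padic_rep\<close> picks a representative.\<close>

definition padic_of :: "(nat \<Rightarrow> rat) \<Rightarrow> 'p::prime_card padic" where
  "padic_of X = Abs_padic (padic_rel CARD('p) `` {X})"

definition padic_rep :: "'p::prime_card padic \<Rightarrow> nat \<Rightarrow> rat" where
  "padic_rep x = (SOME X. X \<in> Rep_padic x)"

lemma padic_rep_Cauchy [simp]: "padic_Cauchy CARD('p) (padic_rep (x :: 'p::prime_card padic))"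
  and padic_of_rep [simp]: "padic_of (padic_rep x) = x"
proof -
  note eq = equiv_padic_rel[OF prime_card[where 'a='p]]
  have Q: "Rep_padic x \<in> Collect (padic_Cauchy CARD('p)) // padic_rel CARD('p)" by (rule Rep_padic)
  obtain X where "X \<in> Rep_padic x" using in_quotient_imp_non_empty[OF eq Q] by blast
  hence *: "padic_rep x \<in> Rep_padic x" unfolding padic_rep_def by (rule someI[of "\<lambda>X. X \<in> Rep_padic x"])
  thus "padic_Cauchy CARD('p) (padic_rep x)" using in_quotient_imp_subset[OF eq Q] by auto
  have "padic_rel CARD('p) `` {padic_rep x} = Rep_padic x"
  proof -
    obtain X where "Rep_padic x = padic_rel CARD('p) `` {X}" using Q by (rule quotientE)
    thus ?thesis using * equiv_class_eq[OF eq] by blast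
  qed
  thus "padic_of (padic_rep x) = x" by (simp add: padic_of_def Rep_padic_inverse)
qed

lemma padic_of_eq_iff:
  assumes "padic_Cauchy CARD('p) X" "padic_Cauchy CARD('p) Y"
  shows "(padic_of X :: 'p::prime_card padic) = padic_of Y \<longleftrightarrow> padic_null CARD('p) (\<lambda>n. X n - Y n)"
proof -
  note eq = equiv_padic_rel[OF prime_card[where 'a='p]]
  have "(padic_of X :: 'p padic) = padic_of Y
      \<longleftrightarrow> padic_rel CARD('p) `` {X} = padic_rel CARD('p) `` {Y}"
    unfolding padic_of_def using assms by (intro Abs_padic_inject) (auto intro: quotientI)
  also have "\<dots> \<longleftrightarrow> (X, Y) \<in> padic_rel CARD('p)"
    using assms by (intro eq_equiv_class_iff[OF eq]) auto
  finally show ?thesis using assms by (simp add: padic_rel_def)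
qed

lemma padic_rep_of:
  assumes "padic_Cauchy CARD('p) X"
  shows "padic_null CARD('p) (\<lambda>n. padic_rep (padic_of X :: 'p::prime_card padic) n - X n)"
  using padic_of_eq_iff[OF padic_rep_Cauchy assms, of "padic_of X"] by simp

lemma padic_Cauchy_add:
  assumes p: "prime p" and "padic_Cauchy p X" "padic_Cauchy p Y"
  shows "padic_Cauchy p (\<lambda>n. X n + Y n)"
  unfolding padic_Cauchy_def
proof (intro allI impI)
  fix e :: real assume e: "e > 0"
  obtain k where k: "\<And>m n. m \<ge> k \<Longrightarrow> n \<ge> k \<Longrightarrow> rat_pabs p (X m - X n) < e"
    using assms(2) e unfolding padic_Cauchy_def by blast
  obtain l where l: "\<And>m n. m \<ge> l \<Longrightarrow> n \<ge> l \<Longrightarrow> rat_pabs p (Y m - Y n) < e"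
    using assms(3) e unfolding padic_Cauchy_def by blast
  have "rat_pabs p (X m + Y m - (X n + Y n)) < e" if "m \<ge> max k l" "n \<ge> max k l" for m n
    using rat_pabs_ultra[OF p, of "X m - X n" "Y m - Y n"] k[of m n] l[of m n] that
    by (simp add: algebra_simps)
  thus "\<exists>k. \<forall>m\<ge>k. \<forall>n\<ge>k. rat_pabs p (X m + Y m - (X n + Y n)) < e" by blast
qed

lemma padic_Cauchy_minus: "padic_Cauchy p X \<Longrightarrow> padic_Cauchy p (\<lambda>n. - X n)"
  unfolding padic_Cauchy_def by (metis minus_diff_minus rat_pabs_minus)

lemma padic_Cauchy_convergent:
  assumes p: "prime p" and "padic_Cauchy p X" shows "convergent (\<lambda>n. rat_pabs p (X n))"
proof -
  have "Cauchy (\<lambda>n. rat_pabs p (X n))"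
    unfolding Cauchy_def
  proof (intro allI impI)
    fix e :: real assume "e > 0"
    then obtain k where "\<And>m n. m \<ge> k \<Longrightarrow> n \<ge> k \<Longrightarrow> rat_pabs p (X m - X n) < e"
      using assms(2) unfolding padic_Cauchy_def by blast
    thus "\<exists>M. \<forall>m\<ge>M. \<forall>n\<ge>M. dist (rat_pabs p (X m)) (rat_pabs p (X n)) < e"
      using rat_pabs_diff_le[OF p] unfolding dist_real_def by (meson le_less_trans)
  qed
  thus ?thesis by (simp add: Cauchy_convergent_iff)
qed

lemma padic_Cauchy_bounded:
  assumes p: "prime p" and "padic_Cauchy p X" obtains B where "B > 0" "\<And>n. rat_pabs p (X n) \<le> B"
proof -
  have "Bseq (\<lambda>n. rat_pabs p (X n))"
    using padic_Cauchy_convergent[OF assms] by (rule convergent_imp_Bseq)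
  then obtain B where "B > 0" "\<And>n. norm (rat_pabs p (X n)) \<le> B" by (auto elim: BseqE)
  thus thesis using that by (auto simp: abs_le_iff)
qed

lemma padic_Cauchy_mult:
  assumes p: "prime p" and X: "padic_Cauchy p X" and Y: "padic_Cauchy p Y"
  shows "padic_Cauchy p (\<lambda>n. X n * Y n)"
  unfolding padic_Cauchy_def
proof (intro allI impI)
  fix e :: real assume e: "e > 0"
  obtain A where A: "A > 0" "\<And>n. rat_pabs p (X n) \<le> A" by (rule padic_Cauchy_bounded[OF p X]) blast
  obtain B where B: "B > 0" "\<And>n. rat_pabs p (Y n) \<le> B" by (rule padic_Cauchy_bounded[OF p Y]) blast
  have "e / B > 0" "e / A > 0" using e A B by auto
  obtain k where k: "\<And>m n. m \<ge> k \<Longrightarrow> n \<ge> k \<Longrightarrow> rat_pabs p (X m - X n) < e / B"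
    using X \<open>e / B > 0\<close> unfolding padic_Cauchy_def by blast
  obtain l where l: "\<And>m n. m \<ge> l \<Longrightarrow> n \<ge> l \<Longrightarrow> rat_pabs p (Y m - Y n) < e / A"
    using Y \<open>e / A > 0\<close> unfolding padic_Cauchy_def by blast
  have "rat_pabs p (X m * Y m - X n * Y n) < e" if mn: "m \<ge> max k l" "n \<ge> max k l" for m n
  proof -
    have eq: "X m * Y m - X n * Y n = (X m - X n) * Y m + X n * (Y m - Y n)"
      by (simp add: algebra_simps)
    have "rat_pabs p (X m - X n) * rat_pabs p (Y m) \<le> rat_pabs p (X m - X n) * B"
      using B rat_pabs_nonneg[OF p] by (intro mult_left_mono) auto
    also have "\<dots> < e" using k[of m n] mn B by (simp add: pos_less_divide_eq)
    finally have 1: "rat_pabs p ((X m - X n) * Y m) < e" by (simp add: rat_pabs_mult[OF p])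
    have "rat_pabs p (X n) * rat_pabs p (Y m - Y n) \<le> A * rat_pabs p (Y m - Y n)"
      using A rat_pabs_nonneg[OF p] by (intro mult_right_mono) auto
    also have "\<dots> < e" using l[of m n] mn A by (simp add: pos_less_divide_eq mult.commute)
    finally have 2: "rat_pabs p (X n * (Y m - Y n)) < e" by (simp add: rat_pabs_mult[OF p])
    show ?thesis unfolding eq
      using rat_pabs_ultra[OF p, of "(X m - X n) * Y m" "X n * (Y m - Y n)"] 1 2 by linarith
  qed
  thus "\<exists>k. \<forall>m\<ge>k. \<forall>n\<ge>k. rat_pabs p (X m * Y m - X n * Y n) < e" by blast
qed

lemma padic_null_mult_bounded:
  assumes p: "prime p" and X: "padic_null p X" and Y: "padic_Cauchy p Y"
  shows "padic_null p (\<lambda>n. X n * Y n)"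
proof -
  obtain B where B: "B > 0" "\<And>n. rat_pabs p (Y n) \<le> B" by (rule padic_Cauchy_bounded[OF p Y]) blast
  have "rat_pabs p (X n * Y n) \<le> B * rat_pabs p (X n)" for n
    using mult_right_mono[OF B(2)[of n] rat_pabs_nonneg[OF p, of "X n"]]
    by (simp add: rat_pabs_mult[OF p] mult.commute)
  thus ?thesis by (intro padic_null_le[OF p X always_eventually]) blast
qed

lemma padic_Cauchy_not_null:
  assumes p: "prime p" and X: "padic_Cauchy p X" "\<not> padic_null p X"
  obtains c where "c > 0" "eventually (\<lambda>n. rat_pabs p (X n) > c) sequentially"
proof -
  obtain L where L: "(\<lambda>n. rat_pabs p (X n)) \<longlonglongrightarrow> L"
    using padic_Cauchy_convergent[OF p X(1)] by (auto simp: convergent_def)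
  have "L \<ge> 0" using L rat_pabs_nonneg[OF p] by (intro LIMSEQ_le_const) auto
  moreover have "L \<noteq> 0" using X(2) L by (auto simp: padic_null_def)
  ultimately have "L / 2 > 0" "L / 2 < L" by auto
  thus thesis using that order_tendstoD(1)[OF L] by blast
qed

lemma padic_Cauchy_inverse:
  assumes p: "prime p" and X: "padic_Cauchy p X" "\<not> padic_null p X"
  shows "padic_Cauchy p (\<lambda>n. inverse (X n))"
  unfolding padic_Cauchy_def
proof (intro allI impI)
  fix e :: real assume e: "e > 0"
  obtain c where c: "c > 0" "eventually (\<lambda>n. rat_pabs p (X n) > c) sequentially"
    using padic_Cauchy_not_null[OF p X] .
  obtain l where l: "\<And>n. n \<ge> l \<Longrightarrow> rat_pabs p (X n) > c"
    using c(2) unfolding eventually_sequentially by blast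
  have "e * (c * c) > 0" using e c by simp
  then obtain k where k: "\<And>m n. m \<ge> k \<Longrightarrow> n \<ge> k \<Longrightarrow> rat_pabs p (X m - X n) < e * (c * c)"
    using X(1) unfolding padic_Cauchy_def by blast
  have "rat_pabs p (inverse (X m) - inverse (X n)) < e" if mn: "m \<ge> max k l" "n \<ge> max k l" for m n
  proof -
    have lm: "rat_pabs p (X m) > c" "rat_pabs p (X n) > c" using l mn by auto
    have nz: "X m \<noteq> 0" "X n \<noteq> 0" using lm c(1) by auto
    have "inverse (X m) - inverse (X n) = (X n - X m) * inverse (X m * X n)"
      using nz by (simp add: field_simps)
    hence eq: "rat_pabs p (inverse (X m) - inverse (X n))
        = rat_pabs p (X n - X m) / (rat_pabs p (X m) * rat_pabs p (X n))"
      by (simp add: rat_pabs_mult[OF p] rat_pabs_inverse[OF p] divide_inverse)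
    have "c * c \<le> rat_pabs p (X m) * rat_pabs p (X n)"
      using lm c(1) by (intro mult_mono) auto
    hence "e * (c * c) \<le> e * (rat_pabs p (X m) * rat_pabs p (X n))" using e by simp
    moreover have "rat_pabs p (X n - X m) < e * (c * c)" using k mn by simp
    moreover have "rat_pabs p (X m) * rat_pabs p (X n) > 0" using lm c(1) by simp
    ultimately show ?thesis unfolding eq by (simp add: pos_divide_less_eq)
  qed
  thus "\<exists>k. \<forall>m\<ge>k. \<forall>n\<ge>k. rat_pabs p (inverse (X m) - inverse (X n)) < e" by blast
qed

instantiation padic :: (prime_card) field
begin

definition zero_padic :: "'a padic" where "0 = padic_of (\<lambda>n. 0)"
definition one_padic :: "'a padic" where "1 = padic_of (\<lambda>n. 1)"
definition plus_padic :: "'a padic \<Rightarrow> 'a padic \<Rightarrow> 'a padic" where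
  "x + y = padic_of (\<lambda>n. padic_rep x n + padic_rep y n)"
definition uminus_padic :: "'a padic \<Rightarrow> 'a padic" where
  "- x = padic_of (\<lambda>n. - padic_rep x n)"
definition minus_padic :: "'a padic \<Rightarrow> 'a padic \<Rightarrow> 'a padic" where
  "minus_padic x y = x + (- y)"
definition times_padic :: "'a padic \<Rightarrow> 'a padic \<Rightarrow> 'a padic" where
  "x * y = padic_of (\<lambda>n. padic_rep x n * padic_rep y n)"
definition inverse_padic :: "'a padic \<Rightarrow> 'a padic" where
  "inverse_padic x = (if x = 0 then 0 else padic_of (\<lambda>n. inverse (padic_rep x n)))"
definition divide_padic :: "'a padic \<Rightarrow> 'a padic \<Rightarrow> 'a padic" where
  "divide_padic x y = x * inverse y"

lemma padic_of_add:
  assumes X: "padic_Cauchy CARD('a) X" and Y: "padic_Cauchy CARD('a) Y"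
  shows "(padic_of X + padic_of Y :: 'a padic) = padic_of (\<lambda>n. X n + Y n)"
proof -
  note p = prime_card[where 'a='a]
  show ?thesis unfolding plus_padic_def
    using padic_null_add[OF p padic_rep_of[OF X] padic_rep_of[OF Y]]
    by (subst padic_of_eq_iff) (auto intro!: padic_Cauchy_add[OF p] X Y simp: algebra_simps)
qed

lemma padic_of_minus:
  assumes X: "padic_Cauchy CARD('a) X"
  shows "- (padic_of X :: 'a padic) = padic_of (\<lambda>n. - X n)"
proof -
  define Y where "Y = padic_rep (padic_of X :: 'a padic)"
  have Y: "padic_Cauchy CARD('a) Y" by (simp add: Y_def)
  have "padic_null CARD('a) (\<lambda>n. - (Y n - X n))"
    unfolding padic_null_minus Y_def by (rule padic_rep_of[OF X])
  hence "padic_null CARD('a) (\<lambda>n. - Y n - - X n)" by simp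
  thus ?thesis unfolding uminus_padic_def Y_def[symmetric]
    using padic_of_eq_iff[OF padic_Cauchy_minus[OF Y] padic_Cauchy_minus[OF X]] by blast
qed

lemma padic_of_mult:
  assumes X: "padic_Cauchy CARD('a) X" and Y: "padic_Cauchy CARD('a) Y"
  shows "(padic_of X * padic_of Y :: 'a padic) = padic_of (\<lambda>n. X n * Y n)"
proof -
  note p = prime_card[where 'a='a]
  define X' where "X' = padic_rep (padic_of X :: 'a padic)"
  define Y' where "Y' = padic_rep (padic_of Y :: 'a padic)"
  have C: "padic_Cauchy CARD('a) X'" "padic_Cauchy CARD('a) Y'" by (simp_all add: X'_def Y'_def)
  have "padic_null CARD('a) (\<lambda>n. (X' n - X n) * Y' n + (Y' n - Y n) * X n)"
    unfolding X'_def Y'_def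
    by (intro padic_null_add[OF p] padic_null_mult_bounded[OF p] padic_rep_of X Y padic_rep_Cauchy)
  hence "padic_null CARD('a) (\<lambda>n. X' n * Y' n - X n * Y n)" by (simp add: algebra_simps)
  thus ?thesis unfolding times_padic_def X'_def[symmetric] Y'_def[symmetric]
    by (subst padic_of_eq_iff) (auto intro!: padic_Cauchy_mult[OF p] X Y C)
qed

lemma padic_of_eq_0_iff:
  assumes X: "padic_Cauchy CARD('a) X"
  shows "(padic_of X :: 'a padic) = 0 \<longleftrightarrow> padic_null CARD('a) X"
  unfolding zero_padic_def using padic_of_eq_iff[OF X padic_Cauchy_const, of 0] by simp

instance
proof
  note p = prime_card[where 'a='a]
  fix a b c :: "'a padic"
  obtain A B C where abc: "a = padic_of A" "b = padic_of B" "c = padic_of C"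
    and [simp]: "padic_Cauchy CARD('a) A" "padic_Cauchy CARD('a) B" "padic_Cauchy CARD('a) C"
    by (metis padic_of_rep padic_rep_Cauchy)
  note [simp] = padic_Cauchy_add[OF p] padic_Cauchy_mult[OF p] padic_Cauchy_minus
    padic_of_add padic_of_mult padic_of_minus
  show "a + b = b + a" "(a + b) + c = a + (b + c)" "(a * b) * c = a * (b * c)" "a * b = b * a"
    by (simp_all add: abc algebra_simps)
  show "0 + a = a" "1 * a = a" "- a + a = 0"
    by (simp_all add: abc zero_padic_def one_padic_def)
  show "(a + b) * c = a * c + b * c"
    by (simp add: abc distrib_right)
  show "a - b = a + - b" by (rule minus_padic_def)
  show "a div b = a * inverse b" by (rule divide_padic_def)
  show "inverse (0::'a padic) = 0" by (simp add: inverse_padic_def)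
  have "\<not> padic_null CARD('a) (\<lambda>n. 1)"
    by (simp add: padic_null_def LIMSEQ_const_iff)
  thus "(0::'a padic) \<noteq> 1"
    using padic_of_eq_0_iff[OF padic_Cauchy_const, of 1] unfolding one_padic_def by metis
  show "inverse a * a = 1" if "a \<noteq> 0"
  proof -
    define X where "X = padic_rep a"
    have X: "padic_Cauchy CARD('a) X" "a = padic_of X" by (simp_all add: X_def)
    have n: "\<not> padic_null CARD('a) X" using that X padic_of_eq_0_iff by blast
    note I = padic_Cauchy_inverse[OF p X(1) n]
    obtain d where d: "d > 0" "eventually (\<lambda>n. rat_pabs CARD('a) (X n) > d) sequentially"
      using padic_Cauchy_not_null[OF p X(1) n] .
    have "inverse a * a = padic_of (\<lambda>n. inverse (X n) * X n)"
      using padic_of_mult[OF I X(1)] that unfolding inverse_padic_def X(2)[symmetric]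
      by (simp add: X_def[symmetric])
    also have "\<dots> = 1"
      unfolding one_padic_def
    proof (subst padic_of_eq_iff)
      have "eventually (\<lambda>n. rat_pabs CARD('a) (inverse (X n) * X n - 1) = 0) sequentially"
        using d(2)
      proof eventually_elim
        case (elim n)
        hence "X n \<noteq> 0" using d(1) by auto
        thus ?case by simp
      qed
      thus "padic_null CARD('a) (\<lambda>n. inverse (X n) * X n - 1)"
        unfolding padic_null_def by (rule tendsto_eventually)
    qed (simp_all add: padic_Cauchy_mult[OF p I X(1)])
    finally show ?thesis .
  qed
qed

end

definition padic_norm :: "'p::prime_card padic \<Rightarrow> real" where
  "padic_norm x = lim (\<lambda>n. rat_pabs CARD('p) (padic_rep x n))"

lemma padic_norm_LIMSEQ:
  assumes X: "padic_Cauchy CARD('p) X"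
  shows "(\<lambda>n. rat_pabs CARD('p) (X n)) \<longlonglongrightarrow> padic_norm (padic_of X :: 'p::prime_card padic)"
proof -
  note p = prime_card[where 'a='p]
  define Y where "Y = padic_rep (padic_of X :: 'p padic)"
  have Y: "(\<lambda>n. rat_pabs CARD('p) (Y n)) \<longlonglongrightarrow> padic_norm (padic_of X :: 'p padic)"
    using padic_Cauchy_convergent[OF p, of Y] by (simp add: padic_norm_def Y_def convergent_LIMSEQ_iff)
  have "(\<lambda>n. rat_pabs CARD('p) (Y n - X n)) \<longlonglongrightarrow> 0"
    using padic_rep_of[OF X] by (simp add: padic_null_def Y_def)
  hence "(\<lambda>n. rat_pabs CARD('p) (Y n) - rat_pabs CARD('p) (X n)) \<longlonglongrightarrow> 0"
    by (rule Lim_null_comparison[rotated]) (simp add: rat_pabs_diff_le[OF p])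
  from tendsto_diff[OF Y this] show ?thesis by simp
qed

lemma padic_norm_eq_0_iff: "padic_norm (x :: 'p::prime_card padic) = 0 \<longleftrightarrow> x = 0"
proof -
  have L: "(\<lambda>n. rat_pabs CARD('p) (padic_rep x n)) \<longlonglongrightarrow> padic_norm x"
    using padic_norm_LIMSEQ[OF padic_rep_Cauchy, of x] by simp
  have "x = 0 \<longleftrightarrow> padic_null CARD('p) (padic_rep x)"
    using padic_of_eq_0_iff[OF padic_rep_Cauchy, of x] by simp
  thus ?thesis unfolding padic_null_def using L LIMSEQ_unique by metis
qed

lemma padic_norm_mult: "padic_norm (x * y) = padic_norm x * padic_norm (y :: 'p::prime_card padic)"
proof -
  note p = prime_card[where 'a='p]
  define X Y where "X = padic_rep x" and "Y = padic_rep y"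
  have C: "padic_Cauchy CARD('p) X" "padic_Cauchy CARD('p) Y"
    by (simp_all add: X_def Y_def)
  have xy: "x = padic_of X" "y = padic_of Y"
    by (simp_all add: X_def Y_def)
  have "(\<lambda>n. rat_pabs CARD('p) (X n * Y n)) \<longlonglongrightarrow> padic_norm x * padic_norm y"
    unfolding rat_pabs_mult[OF p] xy by (intro tendsto_mult padic_norm_LIMSEQ C)
  moreover have "(\<lambda>n. rat_pabs CARD('p) (X n * Y n)) \<longlonglongrightarrow> padic_norm (x * y)"
    unfolding xy padic_of_mult[OF C(1,2)]
    by (intro padic_norm_LIMSEQ padic_Cauchy_mult[OF p] C)
  ultimately show ?thesis by (metis LIMSEQ_unique)
qed

lemma padic_norm_minus: "padic_norm (- x) = padic_norm (x :: 'p::prime_card padic)"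
proof -
  define X where "X = padic_rep x"
  have C: "padic_Cauchy CARD('p) X" "x = padic_of X" by (simp_all add: X_def)
  show ?thesis
    using padic_norm_LIMSEQ[OF C(1)] padic_norm_LIMSEQ[OF padic_Cauchy_minus[OF C(1)]]
    unfolding C(2) padic_of_minus[OF C(1)] by (simp add: LIMSEQ_unique)
qed

lemma padic_norm_ultra: "padic_norm (x + y) \<le> max (padic_norm x) (padic_norm (y :: 'p::prime_card padic))"
proof -
  note p = prime_card[where 'a='p]
  define X Y where "X = padic_rep x" and "Y = padic_rep y"
  have C: "padic_Cauchy CARD('p) X" "padic_Cauchy CARD('p) Y"
    by (simp_all add: X_def Y_def)
  have xy: "x = padic_of X" "y = padic_of Y"
    by (simp_all add: X_def Y_def)
  have "(\<lambda>n. max (rat_pabs CARD('p) (X n)) (rat_pabs CARD('p) (Y n))) \<longlonglongrightarrow> max (padic_norm x) (padic_norm y)"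
    unfolding xy by (intro tendsto_max padic_norm_LIMSEQ C)
  moreover have "(\<lambda>n. rat_pabs CARD('p) (X n + Y n)) \<longlonglongrightarrow> padic_norm (x + y)"
    unfolding xy padic_of_add[OF C(1,2)]
    by (intro padic_norm_LIMSEQ padic_Cauchy_add[OF p] C)
  ultimately show ?thesis
    by (intro tendsto_le[of sequentially]) (auto simp: rat_pabs_ultra[OF p])
qed

lemma padic_norm_nonneg: "padic_norm (x :: 'p::prime_card padic) \<ge> 0"
  using padic_norm_LIMSEQ[OF padic_rep_Cauchy, of x] rat_pabs_nonneg[OF prime_card[where 'a='p]]
  by (intro LIMSEQ_le_const) auto

instantiation padic :: (prime_card) metric_space
begin

definition dist_padic :: "'a padic \<Rightarrow> 'a padic \<Rightarrow> real" where
  "dist_padic x y = padic_norm (x - y)"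
definition uniformity_padic :: "('a padic \<times> 'a padic) filter" where
  "uniformity_padic = (INF e\<in>{0<..}. principal {(x, y). dist x y < e})"
definition open_padic :: "'a padic set \<Rightarrow> bool" where
  "open_padic U \<longleftrightarrow> (\<forall>x\<in>U. \<forall>\<^sub>F (x', y) in uniformity. x' = x \<longrightarrow> y \<in> U)"

instance
proof
  fix x y z :: "'a padic" and U :: "'a padic set"
  show "uniformity = (INF e\<in>{0<..}. principal {(x, y). dist (x::'a padic) y < e})"
    by (rule uniformity_padic_def)
  show "open U \<longleftrightarrow> (\<forall>x\<in>U. \<forall>\<^sub>F (x', y) in uniformity. x' = x \<longrightarrow> y \<in> U)"
    by (rule open_padic_def)
  show "dist x y = 0 \<longleftrightarrow> x = y" by (simp add: dist_padic_def padic_norm_eq_0_iff)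
  show "dist x y \<le> dist x z + dist y z"
    using padic_norm_ultra[of "x - z" "z - y"] padic_norm_minus[of "y - z"]
      padic_norm_nonneg[of "x - z"] padic_norm_nonneg[of "z - y"]
    by (simp add: dist_padic_def)
qed

end

text \<open>The construction really is the completion of \<open>rat\<close> for \<open>rat_pabs\<close>: the embedding of \<open>rat\<close> is
  a norm-preserving ring homomorphism with dense image, and the metric is complete.\<close>

definition padic_const :: "rat \<Rightarrow> 'p::prime_card padic" where
  "padic_const q = padic_of (\<lambda>n. q)"

lemma padic_const_hom:
  fixes c :: "rat \<Rightarrow> 'p::prime_card padic"
  defines "c \<equiv> padic_const"
  shows "c 0 = 0" "c 1 = 1" "c (a + b) = c a + c b" "c (a * b) = c a * c b"
  unfolding c_def
  by (simp_all add: padic_const_def zero_padic_def one_padic_def padic_of_add padic_of_mult)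

lemma padic_norm_const: "padic_norm (padic_const q :: 'p::prime_card padic) = rat_pabs CARD('p) q"
  using padic_norm_LIMSEQ[OF padic_Cauchy_const, of q, where 'p='p]
  by (simp add: padic_const_def LIMSEQ_const_iff)

lemma padic_const_diff: "(padic_const (a - b) :: 'p::prime_card padic) = padic_const a - padic_const b"
  using padic_const_hom(3)[of "a - b" b, where 'p='p] by (simp add: eq_diff_eq)

lemma padic_const_tendsto:
  assumes X: "padic_Cauchy CARD('p) X"
  shows "(\<lambda>n. padic_const (X n)) \<longlonglongrightarrow> (padic_of X :: 'p::prime_card padic)"
proof (rule metric_LIMSEQ_I)
  note p = prime_card[where 'a='p]
  fix e :: real assume "e > 0"
  hence "e / 2 > 0" by simp
  then obtain k where k: "\<And>m n. m \<ge> k \<Longrightarrow> n \<ge> k \<Longrightarrow> rat_pabs CARD('p) (X m - X n) < e / 2"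
    using X unfolding padic_Cauchy_def by blast
  have "dist (padic_const (X n)) (padic_of X :: 'p padic) < e" if n: "n \<ge> k" for n
  proof -
    have C: "padic_Cauchy CARD('p) (\<lambda>m. X m - X n)"
      using padic_Cauchy_add[OF p X padic_Cauchy_const[of _ "- X n"]] by simp
    have "padic_of (\<lambda>m. X m - X n) = padic_of X - (padic_const (X n) :: 'p padic)"
      using padic_of_add[OF C padic_Cauchy_const[of _ "X n"]]
      by (simp add: padic_const_def eq_diff_eq)
    hence "(\<lambda>m. rat_pabs CARD('p) (X m - X n)) \<longlonglongrightarrow> dist (padic_const (X n)) (padic_of X :: 'p padic)"
      using padic_norm_LIMSEQ[OF C] by (metis dist_commute dist_padic_def)
    moreover have "\<forall>m\<ge>k. rat_pabs CARD('p) (X m - X n) \<le> e / 2" using k[OF _ n] by (simp add: less_imp_le)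
    ultimately have "dist (padic_const (X n)) (padic_of X :: 'p padic) \<le> e / 2"
      by (intro LIMSEQ_le_const2) auto
    thus ?thesis using \<open>e > 0\<close> by linarith
  qed
  thus "\<exists>k. \<forall>n\<ge>k. dist (padic_const (X n)) (padic_of X :: 'p padic) < e" by blast
qed

lemma padic_const_dense:
  assumes "e > 0" obtains q where "dist (padic_const q) (x :: 'p::prime_card padic) < e"
  using padic_const_tendsto[OF padic_rep_Cauchy, of x] assms metric_LIMSEQ_D[of _ x e]
  by fastforce

instance padic :: (prime_card) complete_space
proof
  fix f :: "nat \<Rightarrow> 'a padic" assume f: "Cauchy f"
  note p = prime_card[where 'a='a]
  have "\<exists>q. dist (padic_const q) (f n) < inverse (real (Suc n))" for n
    by (rule padic_const_dense[of "inverse (real (Suc n))" "f n"]) auto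
  then obtain X where X: "\<And>n. dist (padic_const (X n)) (f n) < inverse (real (Suc n))" by metis
  have lim0: "(\<lambda>n. dist (padic_const (X n)) (f n)) \<longlonglongrightarrow> 0"
    by (rule tendsto_sandwich[OF always_eventually always_eventually tendsto_const LIMSEQ_inverse_real_of_nat])
       (use X less_imp_le in \<open>blast intro: zero_le_dist\<close>)+
  have "padic_Cauchy CARD('a) X"
    unfolding padic_Cauchy_def
  proof (intro allI impI)
    fix e :: real assume "e > 0"
    hence e: "e / 3 > 0" by simp
    obtain k where k: "\<And>m n. m \<ge> k \<Longrightarrow> n \<ge> k \<Longrightarrow> dist (f m) (f n) < e / 3"
      using f e unfolding Cauchy_def by blast
    obtain l where l: "\<And>n. n \<ge> l \<Longrightarrow> dist (padic_const (X n)) (f n) < e / 3"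
      using order_tendstoD(2)[OF lim0 e] unfolding eventually_sequentially by blast
    have "rat_pabs CARD('a) (X m - X n) < e" if mn: "m \<ge> max k l" "n \<ge> max k l" for m n
    proof -
      have "rat_pabs CARD('a) (X m - X n) = dist (padic_const (X m) :: 'a padic) (padic_const (X n))"
        by (simp add: dist_padic_def padic_const_diff[symmetric] padic_norm_const)
      also have "\<dots> \<le> dist (padic_const (X m)) (f m) + dist (f m) (f n) + dist (padic_const (X n)) (f n)"
        using dist_triangle[of "padic_const (X m)" "padic_const (X n)" "f m"]
          dist_triangle[of "f m" "padic_const (X n)" "f n"] dist_commute[of "f n" "padic_const (X n)"]
        by linarith
      also have "\<dots> < e" using k[of m n] l[of m] l[of n] mn by simp
      finally show ?thesis .
    qed
    thus "\<exists>k. \<forall>m\<ge>k. \<forall>n\<ge>k. rat_pabs CARD('a) (X m - X n) < e" by blast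
  qed
  hence "(\<lambda>n. padic_const (X n)) \<longlonglongrightarrow> (padic_of X :: 'a padic)" by (rule padic_const_tendsto)
  hence "(\<lambda>n. dist (padic_const (X n)) (padic_of X :: 'a padic)) \<longlonglongrightarrow> 0"
    by (rule tendsto_dist_iff[THEN iffD1])
  from tendsto_add[OF lim0 this]
  have "(\<lambda>n. dist (padic_const (X n)) (f n) + dist (padic_const (X n)) (padic_of X :: 'a padic)) \<longlonglongrightarrow> 0"
    by simp
  hence "(\<lambda>n. dist (f n) (padic_of X)) \<longlonglongrightarrow> 0"
    by (rule Lim_null_comparison[rotated]) (simp add: dist_triangle3)
  hence "f \<longlonglongrightarrow> padic_of X" by (rule tendsto_dist_iff[THEN iffD2])
  thus "convergent f" by (auto simp: convergent_def)
qed

section \<open>Analytic maps and their differentials\<close>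

definition padic_int :: "'p::prime_card padic set" where
  "padic_int = {x. padic_norm x \<le> 1}"

text \<open>Multi-indices are functions \<open>'n \<Rightarrow> nat\<close>. As the norm is complete and non-archimedean,
  unconditional summability is the same as the terms tending to zero, i.e. convergence.\<close>

definition has_power_series_on ::
  "('p::prime_card padic^'n \<Rightarrow> 'p padic^'m) \<Rightarrow> 'p padic^'n \<Rightarrow> (('n \<Rightarrow> nat) \<Rightarrow> 'p padic^'m)
    \<Rightarrow> ('p padic^'n) set \<Rightarrow> bool" where
  "has_power_series_on f a c U \<longleftrightarrow>
    (\<forall>x\<in>U. ((\<lambda>\<alpha>. (\<Prod>i\<in>UNIV. (x $ i - a $ i) ^ \<alpha> i) *s c \<alpha>) has_sum f x) UNIV)"

definition padic_analytic_on ::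
  "('p::prime_card padic^'n) set \<Rightarrow> ('p padic^'n \<Rightarrow> 'p padic^'m) \<Rightarrow> bool" where
  "padic_analytic_on D f \<longleftrightarrow>
    (\<exists>\<U>. \<Union>\<U> = D \<and> (\<forall>U\<in>\<U>. open U \<and> (\<exists>a\<in>U. \<exists>c. has_power_series_on f a c U)))"

text \<open>The library derivatives need real normed spaces, so the differential is given by the matrix of
  partial derivatives, taken as limits of difference quotients. These limits exist for analytic maps.\<close>

definition jacobian ::
  "('p::prime_card padic^'n \<Rightarrow> 'p padic^'m) \<Rightarrow> 'p padic^'n \<Rightarrow> 'p padic^'n^'m" where
  "jacobian f a = (\<chi> i j. Lim (at 0) (\<lambda>h. (f (a + h *s axis j 1) $ i - f a $ i) / h))"

definition pushforward ::
  "('p::prime_card padic^'n \<Rightarrow> 'p padic^'m) \<Rightarrow> 'p padic^'n \<Rightarrow> 'p padic^'n \<Rightarrow> 'p padic^'m" where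
  "pushforward f a v = jacobian f a *v v"

definition differential ::
  "('p::prime_card padic^'n \<Rightarrow> 'p padic) \<Rightarrow> 'p padic^'n \<Rightarrow> 'p padic^'n \<Rightarrow> 'p padic" where
  "differential f a v = pushforward (\<lambda>x. vec (f x) :: 'p padic^1) a v $ 1"

section \<open>Symplectic actions of the additive group on open subsets of the plane\<close>

text \<open>A 2-form takes a base point and two tangent vectors.\<close>

type_synonym 'p two_form = "'p padic^2 \<Rightarrow> 'p padic^2 \<Rightarrow> 'p padic^2 \<Rightarrow> 'p padic"

type_synonym 'p action = "'p padic \<Rightarrow> 'p padic^2 \<Rightarrow> 'p padic^2"

definition padic_int_plane :: "('p::prime_card padic^2) set" where
  "padic_int_plane = {m. m $ 1 \<in> padic_int \<and> m $ 2 \<in> padic_int}"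

definition wedge ::
  "('p::prime_card padic^2 \<Rightarrow> 'p padic^2 \<Rightarrow> 'p padic) \<Rightarrow> ('p padic^2 \<Rightarrow> 'p padic^2 \<Rightarrow> 'p padic)
    \<Rightarrow> 'p two_form" where
  "wedge \<alpha> \<beta> m u v = \<alpha> m u * \<beta> m v - \<alpha> m v * \<beta> m u"

definition dx_dy :: "'p::prime_card two_form" where
  "dx_dy = wedge (differential (\<lambda>m. m $ 1)) (differential (\<lambda>m. m $ 2))"

definition pullback :: "('p::prime_card padic^2 \<Rightarrow> 'p padic^2) \<Rightarrow> 'p two_form \<Rightarrow> 'p two_form" where
  "pullback f \<omega> m u v = \<omega> (f m) (pushforward f m u) (pushforward f m v)"

text \<open>Analyticity on \<open>UNIV \<times> M\<close> is expressed in the three coordinates of \<open>(g, m)\<close>.\<close>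

definition analytic_symplectic_action ::
  "('p::prime_card padic^2) set \<Rightarrow> 'p two_form \<Rightarrow> 'p action \<Rightarrow> bool" where
  "analytic_symplectic_action M \<omega> \<psi> \<longleftrightarrow>
    (\<forall>g. \<forall>m\<in>M. \<psi> g m \<in> M) \<and>
    (\<forall>m\<in>M. \<psi> 0 m = m) \<and>
    (\<forall>g h. \<forall>m\<in>M. \<psi> (g + h) m = \<psi> g (\<psi> h m)) \<and>
    padic_analytic_on {v :: 'p padic^3. vector [v $ 2, v $ 3] \<in> M}
      (\<lambda>v. \<psi> (v $ 1) (vector [v $ 2, v $ 3])) \<and>
    (\<forall>g. \<forall>m\<in>M. \<forall>u v. pullback (\<psi> g) \<omega> m u v = \<omega> m u v)"

definition stabilizer :: "'p::prime_card action \<Rightarrow> 'p padic^2 \<Rightarrow> 'p padic set" where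
  "stabilizer \<psi> m = {g. \<psi> g m = m}"

definition free_action :: "('p::prime_card padic^2) set \<Rightarrow> 'p action \<Rightarrow> bool" where
  "free_action M \<psi> \<longleftrightarrow> (\<forall>m\<in>M. stabilizer \<psi> m = {0})"

definition proper_action :: "('p::prime_card padic^2) set \<Rightarrow> 'p action \<Rightarrow> bool" where
  "proper_action M \<psi> \<longleftrightarrow>
    (\<forall>m g. (\<forall>i::nat. m i \<in> M) \<and> (\<exists>l\<in>M. m \<longlonglongrightarrow> l) \<and> (\<exists>l\<in>M. (\<lambda>i. \<psi> (g i) (m i)) \<longlonglongrightarrow> l)
      \<longrightarrow> (\<exists>r. strict_mono r \<and> convergent (g \<circ> r)))"

definition infinitesimal_action :: "'p::prime_card action \<Rightarrow> 'p padic \<Rightarrow> 'p padic^2 \<Rightarrow> 'p padic^2" where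
  "infinitesimal_action \<psi> \<xi> m = pushforward (\<lambda>g :: 'p padic^1. \<psi> (g $ 1) m) 0 (vec \<xi>)"

text \<open>The Lie algebra is the field itself, and \<open>\<mu> m\<close> is a linear functional on it. Analyticity of
  \<open>\<mu>\<close> is expressed in the coordinate \<open>\<mu> m 1\<close> of the dual.\<close>

definition momentum_map ::
  "('p::prime_card padic^2) set \<Rightarrow> 'p two_form \<Rightarrow> 'p action
    \<Rightarrow> ('p padic^2 \<Rightarrow> 'p padic \<Rightarrow> 'p padic) \<Rightarrow> bool" where
  "momentum_map M \<omega> \<psi> \<mu> \<longleftrightarrow>
    (\<forall>m\<in>M. Vector_Spaces.linear (*) (*) (\<mu> m)) \<and>
    padic_analytic_on M (\<lambda>m. vec (\<mu> m 1) :: 'p padic^1) \<and>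
    (\<forall>\<xi>. \<forall>m\<in>M. \<forall>v. \<omega> m (infinitesimal_action \<psi> \<xi> m) v = differential (\<lambda>m. \<mu> m \<xi>) m v)"

definition hamiltonian_action ::
  "('p::prime_card padic^2) set \<Rightarrow> 'p two_form \<Rightarrow> 'p action \<Rightarrow> bool" where
  "hamiltonian_action M \<omega> \<psi> \<longleftrightarrow>
    (\<exists>\<mu>. momentum_map M \<omega> \<psi> \<mu> \<and> (\<forall>g. \<forall>m\<in>M. \<mu> (\<psi> g m) = \<mu> m))"

end

theory Submission
  imports Defs
begin

text \<open>Fix representatives \<open>d(y)\<close> of the residue classes modulo \<open>p\<close>. The \<open>p\<close>-adic baker's map
  \<open>B(x, y) = (p x + d(y), (y - d(y)) / p)\<close> is an area-preserving bijection of the plane; it moves the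
  lowest digit of \<open>y\<close> to \<open>x\<close> and satisfies \<open>B \<circ> \<tau>\<^sub>a = \<tau>\<^bsub>p a\<^esub> \<circ> B\<close> for the horizontal
  translations \<open>\<tau>\<^sub>a\<close>. Hence \<open>\<psi> g = B\<^sup>-\<^sup>n \<circ> \<tau>\<^sub>a \<circ> B\<^sup>n\<close> with \<open>a = p\<^sup>n g\<close> integral does not depend on
  \<open>n\<close>, and it extends the horizontal translations to a free action of the whole field, which is
  locally a translation, \<open>(g, x, y) \<mapsto> (x + g, y)\<close> up to constants.

  With \<open>\<bar>g\<bar> = p\<^bsup>n+1\<^esup>\<close> one can reach from the origin a point \<open>(0, T\<^sub>n)\<close> with \<open>\<bar>T\<^sub>n\<bar> = p\<^bsup>-n\<^esup>\<close>. These
  returns contradict properness. A momentum map has vertical derivative 1 everywhere, while one which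
  is invariant takes the same value at the points \<open>(0, T\<^sub>n)\<close> and at the origin; as difference
  quotients of a power series converge, its vertical derivative at the origin is 0.\<close>

section \<open>The non-archimedean norm\<close>

lemma padic_norm_0 [simp]: "padic_norm (0 :: 'p::prime_card padic) = 0"
  by (simp add: padic_norm_eq_0_iff)

lemma padic_norm_1 [simp]: "padic_norm (1 :: 'p::prime_card padic) = 1"
  using padic_norm_const[of 1, where 'p='p] by (simp add: padic_const_hom)

lemma padic_norm_pos_iff: "padic_norm (x :: 'p::prime_card padic) > 0 \<longleftrightarrow> x \<noteq> 0"
  using padic_norm_nonneg[of x] padic_norm_eq_0_iff[of x] by linarith

lemma padic_norm_power: "padic_norm (x ^ n) = padic_norm (x :: 'p::prime_card padic) ^ n"
  by (induction n) (simp_all add: padic_norm_mult)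

lemma padic_norm_divide:
  "padic_norm (x / y) = padic_norm x / padic_norm (y :: 'p::prime_card padic)"
proof (cases "y = 0")
  case False
  hence "padic_norm (x / y) * padic_norm y = padic_norm x"
    by (simp add: padic_norm_mult[symmetric])
  thus ?thesis using False by (simp add: eq_divide_eq padic_norm_eq_0_iff)
qed simp

lemma padic_norm_ultra_diff:
  "padic_norm (x - y) \<le> max (padic_norm x) (padic_norm (y :: 'p::prime_card padic))"
  using padic_norm_ultra[of x "- y"] by (simp add: padic_norm_minus)

lemma padic_norm_commute: "padic_norm (x - y) = padic_norm (y - x :: 'p::prime_card padic)"
  using padic_norm_minus[of "x - y"] by simp

lemma padic_norm_diff_trans:
  "padic_norm (x - z) \<le> max (padic_norm (x - y)) (padic_norm (y - z :: 'p::prime_card padic))"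
  using padic_norm_ultra[of "x - y" "y - z"] by simp

lemma padic_norm_sum_le:
  fixes f :: "'i \<Rightarrow> 'p::prime_card padic"
  assumes "B \<ge> 0" and "\<And>i. i \<in> S \<Longrightarrow> padic_norm (f i) \<le> B"
  shows "padic_norm (sum f S) \<le> B"
  using assms(2)
proof (induction S rule: infinite_finite_induct)
  case (insert i S)
  hence "padic_norm (f i) \<le> B" "padic_norm (sum f S) \<le> B" by auto
  thus ?case using padic_norm_ultra[of "f i" "sum f S"] insert.hyps by simp
qed (use assms(1) in auto)

lemma padic_int_closed:
  fixes x y :: "'p::prime_card padic"
  assumes "x \<in> padic_int" "y \<in> padic_int"
  shows "x + y \<in> padic_int" "x - y \<in> padic_int" "x * y \<in> padic_int"
  using assms padic_norm_ultra[of x y] padic_norm_ultra_diff[of x y]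
    mult_le_one[of "padic_norm x" "padic_norm y"]
  by (auto simp: padic_int_def padic_norm_mult padic_norm_nonneg)

lemma zero_in_padic_int [simp]: "0 \<in> padic_int"
  by (simp add: padic_int_def)

section \<open>The uniformizer p and the discreteness of the norm\<close>

definition uniformizer :: "'p::prime_card padic" where
  "uniformizer = of_nat CARD('p)"

lemma prime_card_gt_1: "real CARD('p::prime_card) > 1"
  using prime_gt_1_nat[OF prime_card[where 'a='p]] by simp

lemma padic_const_of_nat: "padic_const (of_nat n) = (of_nat n :: 'p::prime_card padic)"
  by (induction n) (simp_all add: padic_const_hom)

lemma padic_norm_uniformizer:
  "padic_norm (uniformizer :: 'p::prime_card padic) = 1 / real CARD('p)"
proof -
  note p = prime_card[where 'a='p]
  have "rat_pval CARD('p) (of_int (int CARD('p)) / of_int 1) = 1"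
    using prime_gt_1_nat[OF p] by (subst rat_pval_divide[OF p]) (auto simp: multiplicity_self)
  hence "rat_pabs CARD('p) (of_nat CARD('p)) = 1 / real CARD('p)"
    using prime_gt_1_nat[OF p] by (simp add: rat_pabs_def power_int_minus divide_inverse)
  thus ?thesis
    unfolding uniformizer_def padic_const_of_nat[symmetric] padic_norm_const .
qed

lemma uniformizer_nonzero [simp]: "(uniformizer :: 'p::prime_card padic) \<noteq> 0"
  using padic_norm_uniformizer[where 'p='p] prime_card_gt_1[where 'p='p] by auto

lemma padic_norm_uniformizer_power:
  "padic_norm (uniformizer ^ n :: 'p::prime_card padic) = (1 / real CARD('p)) ^ n"
  by (simp add: padic_norm_power padic_norm_uniformizer)

lemma uniformizer_power_in_padic_int: "uniformizer ^ n \<in> padic_int"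
  unfolding padic_int_def mem_Collect_eq padic_norm_uniformizer_power
  using prime_card_gt_1 by (intro power_le_one) (auto intro: less_imp_le)

text \<open>A nonzero element has the norm of any rational that is closer to it than its own norm,
  and norms of nonzero rationals are integer powers of p. So no norm lies strictly between 1/p and
  1.\<close>

lemma padic_norm_less_1:
  fixes x :: "'p::prime_card padic"
  assumes "padic_norm x < 1"
  shows "padic_norm x \<le> 1 / real CARD('p)"
proof (cases "x = 0")
  case False
  hence pos: "padic_norm x > 0" by (simp add: padic_norm_pos_iff)
  then obtain q where q: "dist (padic_const q) x < padic_norm x" by (rule padic_const_dense)
  define y where "y = (padic_const q :: 'p padic)"
  have yx: "padic_norm (y - x) < padic_norm x" using q by (simp add: dist_padic_def y_def)
  have "padic_norm y = padic_norm x"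
  proof (rule antisym)
    show "padic_norm y \<le> padic_norm x" using padic_norm_ultra[of "y - x" x] yx by simp
    show "padic_norm x \<le> padic_norm y" using padic_norm_ultra_diff[of y "y - x"] yx by simp
  qed
  moreover have "q \<noteq> 0" using calculation pos by (auto simp: y_def padic_norm_const)
  ultimately have eq: "padic_norm x = real CARD('p) powi (- rat_pval CARD('p) q)"
    by (simp add: y_def padic_norm_const rat_pabs_def)
  have "- rat_pval CARD('p) q \<le> -1"
  proof (rule ccontr)
    assume "\<not> ?thesis"
    hence "real CARD('p) powi 0 \<le> real CARD('p) powi (- rat_pval CARD('p) q)"
      using prime_card_gt_1[where 'p='p] by (intro power_int_increasing) auto
    thus False using eq assms by simp
  qed
  hence "padic_norm x \<le> real CARD('p) powi -1"
    unfolding eq using prime_card_gt_1[where 'p='p] by (intro power_int_increasing) auto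
  thus ?thesis by (simp add: power_int_minus divide_inverse)
qed simp

lemma divide_uniformizer_in_padic_int:
  assumes "padic_norm (x :: 'p::prime_card padic) < 1"
  shows "x / uniformizer \<in> padic_int"
  using padic_norm_less_1[OF assms] prime_card_gt_1[where 'p='p]
  by (simp add: padic_int_def padic_norm_divide padic_norm_uniformizer field_simps)

lemma padic_norm_uniformizer_mult_less_1:
  assumes "x \<in> padic_int"
  shows "padic_norm (uniformizer * x :: 'p::prime_card padic) < 1"
proof -
  have "padic_norm (uniformizer * x) \<le> 1 / real CARD('p) * 1"
    unfolding padic_norm_mult padic_norm_uniformizer
    using assms by (intro mult_left_mono) (auto simp: padic_int_def)
  also have "\<dots> < 1" using prime_card_gt_1[where 'p='p] by simp
  finally show ?thesis .
qed

lemma exists_uniformizer_power_mult_in_padic_int: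
  "\<exists>n. uniformizer ^ n * (x :: 'p::prime_card padic) \<in> padic_int"
proof -
  obtain n where "padic_norm x < real CARD('p) ^ n"
    using real_arch_pow prime_card_gt_1 by blast
  thus ?thesis
    using prime_card_gt_1[where 'p='p]
    by (intro exI[of _ n])
       (simp add: padic_int_def padic_norm_mult padic_norm_uniformizer_power field_simps)
qed

lemma uniformizer_power_mult_in_padic_int_mono:
  assumes "uniformizer ^ n * x \<in> padic_int" "n \<le> k"
  shows "uniformizer ^ k * (x :: 'p::prime_card padic) \<in> padic_int"
proof -
  have "uniformizer ^ k * x = uniformizer ^ (k - n) * (uniformizer ^ n * x)"
    using assms(2) by (simp add: mult.assoc[symmetric] power_add[symmetric])
  also have "\<dots> \<in> padic_int"
    by (intro padic_int_closed(3) uniformizer_power_in_padic_int assms(1))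
  finally show ?thesis .
qed

section \<open>Continuity of addition and multiplication\<close>

instance padic :: (prime_card) topological_ab_group_add
proof
  fix a b :: "'a padic"
  show "LIM x (nhds a \<times>\<^sub>F nhds b). fst x + snd x :> nhds (a + b)"
    unfolding tendsto_iff
  proof (intro allI impI)
    fix e :: real assume e: "e > 0"
    have "eventually (\<lambda>x. dist x a < e) (nhds a)" "eventually (\<lambda>x. dist x b < e) (nhds b)"
      using e by (auto simp: eventually_nhds_metric)
    hence "eventually (\<lambda>x. dist (fst x) a < e \<and> dist (snd x) b < e) (nhds a \<times>\<^sub>F nhds b)"
      by (rule eventually_prodI[where P = "\<lambda>x. dist x a < e", THEN eventually_mono]) auto
    thus "eventually (\<lambda>x. dist (fst x + snd x) (a + b) < e) (nhds a \<times>\<^sub>F nhds b)"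
    proof eventually_elim
      case (elim x)
      thus ?case using le_less_trans[OF padic_norm_ultra[of "fst x - a" "snd x - b"]]
        by (simp add: dist_padic_def add_diff_add)
    qed
  qed
  have "eventually (\<lambda>x. dist (- x) (- a) < e) (nhds a)" if "e > 0" for e
    using that unfolding eventually_nhds_metric
    by (intro exI[of _ e]) (simp add: dist_padic_def padic_norm_commute)
  thus "(uminus \<longlongrightarrow> - a) (nhds a)" by (auto simp: tendsto_iff)
qed

instance padic :: (prime_card) topological_semigroup_mult
proof
  fix a b :: "'a padic"
  show "LIM x (nhds a \<times>\<^sub>F nhds b). fst x * snd x :> nhds (a * b)"
    unfolding tendsto_iff
  proof (intro allI impI)
    fix e :: real assume e: "e > 0"
    define M where "M = 1 + padic_norm a + padic_norm b"
    have M: "M \<ge> 1" "padic_norm a \<le> M" "padic_norm b \<le> M"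
      using padic_norm_nonneg[of a] padic_norm_nonneg[of b] by (auto simp: M_def)
    \<comment> \<open>The bound 1 keeps the norm of the second factor at most \<open>M\<close>; the
      bound \<open>e / M\<close> then makes both terms of the splitting
      \<open>u * snd x + a * v\<close> smaller than \<open>e\<close>.\<close>
    define d where "d = min 1 (e / M)"
    have d: "d > 0" "d \<le> 1" "d * M \<le> e" using e M by (auto simp: d_def min_def field_simps)
    have "eventually (\<lambda>x. dist x a < d) (nhds a)" "eventually (\<lambda>x. dist x b < d) (nhds b)"
      using d by (auto simp: eventually_nhds_metric)
    hence "eventually (\<lambda>x. dist (fst x) a < d \<and> dist (snd x) b < d) (nhds a \<times>\<^sub>F nhds b)"
      by (rule eventually_prodI[where P = "\<lambda>x. dist x a < d", THEN eventually_mono]) auto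
    thus "eventually (\<lambda>x. dist (fst x * snd x) (a * b) < e) (nhds a \<times>\<^sub>F nhds b)"
    proof eventually_elim
      case (elim x)
      define u v where "u = fst x - a" and "v = snd x - b"
      have uv: "padic_norm u < d" "padic_norm v < d"
        using elim by (auto simp: u_def v_def dist_padic_def)
      have sv: "padic_norm (snd x) \<le> M"
        using padic_norm_ultra[of v b] uv d M by (simp add: v_def)
      have "fst x * snd x - a * b = u * snd x + a * v" by (simp add: u_def v_def algebra_simps)
      moreover have "padic_norm (u * snd x) < e"
      proof -
        have "padic_norm (u * snd x) \<le> padic_norm u * M"
          unfolding padic_norm_mult using sv by (intro mult_left_mono padic_norm_nonneg)
        also have "\<dots> < d * M" using uv M by simp
        finally show ?thesis using d by simp
      qed
      moreover have "padic_norm (a * v) < e"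
      proof -
        have "padic_norm (a * v) \<le> M * padic_norm v"
          unfolding padic_norm_mult using M by (intro mult_right_mono padic_norm_nonneg) auto
        also have "\<dots> < d * M" using uv M by simp
        finally show ?thesis using d by simp
      qed
      ultimately show ?case
        using padic_norm_ultra[of "u * snd x" "a * v"] by (simp add: dist_padic_def)
    qed
  qed
qed

lemma uniformizer_power_tendsto_0:
  "(\<lambda>n. uniformizer ^ n :: 'p::prime_card padic) \<longlonglongrightarrow> 0"
proof -
  have "(\<lambda>n. (1 / real CARD('p)) ^ n) \<longlonglongrightarrow> 0"
    using prime_card_gt_1[where 'p='p] by (intro LIMSEQ_power_zero) simp
  thus ?thesis
    by (subst tendsto_dist_iff) (simp add: dist_padic_def padic_norm_uniformizer_power)
qed

text \<open>The powers of p are nonzero and tend to 0, so 0 is not isolated. Uniqueness of the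
  limits in \<open>jacobian\<close> rests on this.\<close>

lemma padic_at_0_neq_bot [simp]: "at (0 :: 'p::prime_card padic) \<noteq> bot"
proof
  assume "at (0 :: 'p padic) = bot"
  moreover have "filterlim (\<lambda>n. uniformizer ^ n :: 'p padic) (at 0) sequentially"
    using uniformizer_power_tendsto_0 by (simp add: filterlim_at)
  ultimately have "\<forall>P. eventually (\<lambda>n. P (uniformizer ^ n :: 'p padic)) sequentially"
    by (simp add: filterlim_iff)
  from spec[OF this, of "\<lambda>_. False"] show False by simp
qed

section \<open>Power series and partial derivatives\<close>

text \<open>The ultrametric inequality bounds every finite partial sum by \<open>B\<close> itself,
  whatever the number of terms, and partial sums come arbitrarily close to \<open>s\<close>.\<close>

lemma has_sum_padic_norm_le:
  fixes f :: "'i \<Rightarrow> 'p::prime_card padic"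
  assumes sum: "(f has_sum s) A" and "B \<ge> 0" and le: "\<And>i. i \<in> A \<Longrightarrow> padic_norm (f i) \<le> B"
  shows "padic_norm s \<le> B"
proof (rule field_le_epsilon)
  fix e :: real assume "e > 0"
  then obtain F where F: "F \<subseteq> A" "dist (sum f F) s \<le> e"
    using has_sum_finite_approximation[OF sum] by blast
  have "padic_norm (sum f F) \<le> B" using F le by (intro padic_norm_sum_le \<open>B \<ge> 0\<close>) auto
  moreover have "padic_norm (s - sum f F) \<le> e"
    using F(2) by (simp add: dist_padic_def padic_norm_commute)
  ultimately show "padic_norm s \<le> B + e"
    using padic_norm_ultra[of "s - sum f F" "sum f F"] \<open>B \<ge> 0\<close> \<open>e > 0\<close> by simp
qed

text \<open>Outside a suitable finite set, each term is the difference of two partial sums within 1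
  of the total; each of the finitely many other terms is bounded by the sum of their norms.\<close>

lemma has_sum_padic_terms_bounded:
  fixes f :: "'i \<Rightarrow> 'p::prime_card padic"
  assumes "(f has_sum s) A"
  obtains B where "B \<ge> 0" "\<And>i. i \<in> A \<Longrightarrow> padic_norm (f i) \<le> B"
proof -
  have "eventually (\<lambda>F. dist (sum f F) s < 1) (finite_subsets_at_top A)"
    using assms unfolding has_sum_def tendsto_iff by simp
  then obtain X where X: "finite X" "X \<subseteq> A"
    and near: "\<And>Y. finite Y \<Longrightarrow> X \<subseteq> Y \<Longrightarrow> Y \<subseteq> A \<Longrightarrow> padic_norm (sum f Y - s) < 1"
    unfolding eventually_finite_subsets_at_top dist_padic_def by metis
  define B where "B = 1 + (\<Sum>i\<in>X. padic_norm (f i))"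
  have sum_nonneg: "(\<Sum>i\<in>X. padic_norm (f i)) \<ge> 0" by (intro sum_nonneg padic_norm_nonneg)
  have "padic_norm (f i) \<le> B" if "i \<in> A" for i
  proof (cases "i \<in> X")
    case True
    have "padic_norm (f i) \<le> (\<Sum>i\<in>X. padic_norm (f i))"
      using True X by (intro member_le_sum padic_norm_nonneg)
    thus ?thesis by (simp add: B_def)
  next
    case False
    have "f i = (sum f (insert i X) - s) - (sum f X - s)" using False X by simp
    hence "padic_norm (f i) \<le> max (padic_norm (sum f (insert i X) - s)) (padic_norm (sum f X - s))"
      using padic_norm_ultra_diff by metis
    also have "\<dots> \<le> 1" using near[of X] near[of "insert i X"] X that
      by (simp add: subset_insertI less_imp_le)
    finally show ?thesis using sum_nonneg by (simp add: B_def)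
  qed
  thus thesis using sum_nonneg by (intro that[of B]) (auto simp: B_def)
qed

text \<open>Splitting off one factor at a time costs no factor \<open>k\<close> in an ultrametric
  norm. The quotient \<open>s ^ k / s\<close> expresses the exponent k - 1 without truncation at k =
  0.\<close>

lemma padic_norm_power_diff_le:
  fixes x y :: "'p::prime_card padic"
  assumes s: "s > 0" and x: "padic_norm x \<le> s" and y: "padic_norm y \<le> s"
  shows "padic_norm (x ^ k - y ^ k) \<le> padic_norm (x - y) * s ^ k / s"
proof (induction k)
  case 0
  thus ?case using s by (simp add: padic_norm_nonneg)
next
  case (Suc k)
  have eq: "x ^ Suc k - y ^ Suc k = x * (x ^ k - y ^ k) + (x - y) * y ^ k"
    by (simp add: algebra_simps)
  have "padic_norm (x * (x ^ k - y ^ k)) \<le> s * (padic_norm (x - y) * s ^ k / s)"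
    unfolding padic_norm_mult using Suc x s by (intro mult_mono padic_norm_nonneg) auto
  moreover have "padic_norm ((x - y) * y ^ k) \<le> padic_norm (x - y) * s ^ k"
    unfolding padic_norm_mult padic_norm_power
    using y by (intro mult_left_mono power_mono padic_norm_nonneg)
  ultimately show ?case
    unfolding eq using padic_norm_ultra[of "x * (x ^ k - y ^ k)" "(x - y) * y ^ k"] s by simp
qed

text \<open>Second-order estimate for a power; it compares two difference quotients at the
  same point, multiplied through by both increments.\<close>

lemma padic_norm_power_quotient_diff_le:
  fixes b t u :: "'p::prime_card padic"
  assumes s: "s > 0" and b: "padic_norm b \<le> s" and t: "padic_norm t \<le> s" and u: "padic_norm u \<le> s"
  shows "padic_norm (u * ((t + b) ^ k - b ^ k) - t * ((u + b) ^ k - b ^ k))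
    \<le> padic_norm (t * u * (t - u)) * s ^ k / s\<^sup>2"
proof (induction k)
  case 0
  thus ?case using s by (simp add: padic_norm_nonneg)
next
  case (Suc k)
  define E where "E = u * ((t + b) ^ k - b ^ k) - t * ((u + b) ^ k - b ^ k)"
  \<comment> \<open>Splitting one factor off each power leaves a remainder that already carries
    \<open>t * u\<close>; its last factor is a difference of k-th powers and supplies
    \<open>t - u\<close> by the first-order estimate.\<close>
  have eq: "u * ((t + b) ^ Suc k - b ^ Suc k) - t * ((u + b) ^ Suc k - b ^ Suc k)
      = b * E + t * u * ((t + b) ^ k - (u + b) ^ k)"
    by (simp add: E_def algebra_simps)
  have "padic_norm (b * E) \<le> s * (padic_norm (t * u * (t - u)) * s ^ k / s\<^sup>2)"
    unfolding padic_norm_mult[of b] E_def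
    using Suc b s by (intro mult_mono padic_norm_nonneg) auto
  moreover have "padic_norm (t * u * ((t + b) ^ k - (u + b) ^ k))
      \<le> padic_norm (t * u) * (padic_norm (t - u) * s ^ k / s)"
  proof -
    have "padic_norm (t + b) \<le> s" "padic_norm (u + b) \<le> s"
      using padic_norm_ultra[of t b] padic_norm_ultra[of u b] b t u by auto
    from padic_norm_power_diff_le[OF s this, of k] show ?thesis
      unfolding padic_norm_mult[of "t * u"] by (intro mult_left_mono padic_norm_nonneg) simp
  qed
  ultimately show ?case
    unfolding eq
    using padic_norm_ultra[of "b * E" "t * u * ((t + b) ^ k - (u + b) ^ k)"] s
    by (simp add: padic_norm_mult power2_eq_square)
qed

text \<open>Divided by \<open>t * u\<close>, this is a Lipschitz bound for the difference quotients
  at 0. Convergence at one nonzero point \<open>z\<close> bounds all \<open>c i * z ^ k i\<close>,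
  the second-order estimate applies to each term, and the ultrametric inequality carries the common
  bound over to the sum. Exponents may repeat, since the series will come from a multi-index series
  restricted to a line.\<close>

lemma power_series_quotient_diff_le:
  fixes f :: "'p::prime_card padic \<Rightarrow> 'p padic" and c :: "'i \<Rightarrow> 'p padic"
  assumes r: "r > 0"
    and f: "\<And>t. padic_norm t < r \<Longrightarrow> ((\<lambda>i. c i * (t + b) ^ k i) has_sum f t) UNIV"
  shows "\<exists>C\<ge>0. \<exists>\<rho>>0. \<forall>t u. padic_norm t < \<rho> \<longrightarrow> padic_norm u < \<rho> \<longrightarrow>
    padic_norm (u * (f t - f 0) - t * (f u - f 0)) \<le> C * padic_norm (t * u * (t - u))"
proof -
  \<comment> \<open>The radius \<open>s\<close> must be positive, dominate the norm of
    \<open>b\<close> and be attained where the series converges: \<open>b\<close> itself serves (at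
    t = 0) unless it vanishes, and then a small power of p does.\<close>
  have "\<exists>z. z \<noteq> 0 \<and> padic_norm b \<le> padic_norm z \<and> (\<exists>t. padic_norm t < r \<and> z = t + b)"
  proof (cases "b = 0")
    case True
    have "eventually (\<lambda>n. dist (uniformizer ^ n :: 'p padic) 0 < r) sequentially"
      using uniformizer_power_tendsto_0 r by (rule tendstoD)
    then obtain n where "padic_norm (uniformizer ^ n :: 'p padic) < r"
      by (auto simp: eventually_sequentially dist_padic_def)
    thus ?thesis using True by (intro exI[of _ "uniformizer ^ n"]) (auto simp: padic_norm_nonneg)
  next
    case False
    thus ?thesis using r by (intro exI[of _ b]) (auto intro!: exI[of _ 0])
  qed
  then obtain z t0 where z: "z \<noteq> 0" "padic_norm b \<le> padic_norm z" "padic_norm t0 < r" "z = t0 + b"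
    by blast
  define s where "s = padic_norm z"
  have s: "s > 0" using z by (simp add: s_def padic_norm_pos_iff)
  obtain B where B: "B \<ge> 0" "\<And>i. padic_norm (c i * z ^ k i) \<le> B"
    by (rule has_sum_padic_terms_bounded[OF f[OF z(3)]]) (auto simp: z(4))
  have "padic_norm (u * (f t - f 0) - t * (f u - f 0)) \<le> B / s\<^sup>2 * padic_norm (t * u * (t - u))"
    if t: "padic_norm t < min r s" and u: "padic_norm u < min r s" for t u
  proof -
    \<comment> \<open>These are the terms of the combination to be estimated; \<open>f 0\<close>
      enters it with total coefficient \<open>t - u\<close>.\<close>
    define g where "g = (\<lambda>i. c i * (u * ((t + b) ^ k i - b ^ k i) - t * ((u + b) ^ k i - b ^ k i)))"
    have "((\<lambda>i. u * (c i * (t + b) ^ k i) + (- t) * (c i * (u + b) ^ k i)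
        + (t - u) * (c i * (0 + b) ^ k i)) has_sum u * f t + (- t) * f u + (t - u) * f 0) UNIV"
      using t u r by (intro has_sum_add has_sum_cmult_right f) auto
    hence "(g has_sum u * (f t - f 0) - t * (f u - f 0)) UNIV"
      by (simp add: g_def algebra_simps)
    thus ?thesis
    proof (rule has_sum_padic_norm_le)
      show "B / s\<^sup>2 * padic_norm (t * u * (t - u)) \<ge> 0" using B s by (simp add: padic_norm_nonneg)
      fix i
      have "padic_norm (g i) \<le> padic_norm (c i) * (padic_norm (t * u * (t - u)) * s ^ k i / s\<^sup>2)"
        unfolding g_def padic_norm_mult[of "c i"]
        using padic_norm_power_quotient_diff_le[OF s, of b t u "k i"] t u z(2)
        by (intro mult_left_mono padic_norm_nonneg) (simp add: s_def)
      also have "\<dots> = padic_norm (c i * z ^ k i) * (padic_norm (t * u * (t - u)) / s\<^sup>2)"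
        by (simp add: padic_norm_mult padic_norm_power s_def)
      also have "\<dots> \<le> B * (padic_norm (t * u * (t - u)) / s\<^sup>2)"
        using B s by (intro mult_right_mono) (auto simp: padic_norm_nonneg)
      finally show "padic_norm (g i) \<le> B / s\<^sup>2 * padic_norm (t * u * (t - u))" by simp
    qed
  qed
  thus ?thesis using B s r by (intro exI[of _ "B / s\<^sup>2"] exI[of _ "min r s"] conjI) auto
qed

text \<open>Putting \<open>u = T n\<close> removes one of the two differences. Cancelling the norm
  of \<open>T n\<close>, for \<open>T n\<close> smaller than \<open>t\<close>, leaves a bound of
  \<open>f t - f 0\<close> by \<open>C\<close> times the square of the norm of
  \<open>t\<close>.\<close>

lemma power_series_deriv_0_if_returning:
  fixes f :: "'p::prime_card padic \<Rightarrow> 'p padic" and c :: "'i \<Rightarrow> 'p padic"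
  assumes r: "r > 0"
    and f: "\<And>t. padic_norm t < r \<Longrightarrow> ((\<lambda>i. c i * (t + b) ^ k i) has_sum f t) UNIV"
    and T: "T \<longlonglongrightarrow> 0" "\<And>n. T n \<noteq> 0" "\<And>n. f (T n) = f 0"
  shows "((\<lambda>t. (f t - f 0) / t) \<longlongrightarrow> 0) (at 0)"
proof -
  obtain C \<rho> where C: "C \<ge> 0" "\<rho> > 0"
    and est: "\<And>t u. padic_norm t < \<rho> \<Longrightarrow> padic_norm u < \<rho> \<Longrightarrow>
      padic_norm (u * (f t - f 0) - t * (f u - f 0)) \<le> C * padic_norm (t * u * (t - u))"
    using power_series_quotient_diff_le[OF r f] by metis
  have bound: "padic_norm ((f t - f 0) / t) \<le> C * padic_norm t" if t: "padic_norm t < \<rho>" "t \<noteq> 0" for t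
  proof -
    have "eventually (\<lambda>n. dist (T n) 0 < padic_norm t) sequentially"
      using t by (intro tendstoD[OF T(1)]) (simp add: padic_norm_pos_iff)
    then obtain n where n: "padic_norm (T n) < padic_norm t"
      by (auto simp: eventually_sequentially dist_padic_def)
    have "padic_norm (T n * (f t - f 0)) \<le> C * padic_norm (t * T n * (t - T n))"
      using est[of t "T n"] t n by (simp add: T)
    also have "\<dots> \<le> C * (padic_norm (t * T n) * padic_norm t)"
      unfolding padic_norm_mult[of "t * T n"] using C n padic_norm_ultra_diff[of t "T n"]
      by (intro mult_left_mono padic_norm_nonneg) auto
    finally have "padic_norm (T n) * padic_norm (f t - f 0)
        \<le> padic_norm (T n) * (C * padic_norm t * padic_norm t)"
      by (simp add: padic_norm_mult mult_ac)
    hence "padic_norm (f t - f 0) \<le> C * padic_norm t * padic_norm t"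
      using T(2)[of n] by (simp add: padic_norm_pos_iff)
    thus ?thesis using t by (simp add: padic_norm_divide padic_norm_pos_iff pos_divide_le_eq)
  qed
  show ?thesis
    unfolding tendsto_iff
  proof (intro allI impI)
    fix e :: real assume e: "e > 0"
    \<comment> \<open>Dividing by \<open>C + 1\<close> covers the case \<open>C = 0\<close>.\<close>
    define d where "d = min \<rho> (e / (C + 1))"
    have d: "d > 0" using C e by (simp add: d_def)
    have "dist ((f t - f 0) / t) 0 < e" if t: "t \<noteq> 0" "dist t 0 < d" for t
    proof -
      have "padic_norm t < \<rho>" "padic_norm t * (C + 1) < e"
        using t C by (auto simp: d_def dist_padic_def pos_less_divide_eq)
      moreover have "C * padic_norm t \<le> padic_norm t * (C + 1)"
        by (simp add: algebra_simps padic_norm_nonneg)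
      ultimately show ?thesis using bound[of t] t by (simp add: dist_padic_def)
    qed
    thus "eventually (\<lambda>t. dist ((f t - f 0) / t) 0 < e) (at 0)"
      unfolding eventually_at using d by blast
  qed
qed

section \<open>Analytic maps on lines, affine maps and their Jacobians\<close>

text \<open>Along a line parallel to axis \<open>j\<close> only one factor of each monomial varies,
  and the others are absorbed into the coefficient. The series keeps its expansion centre, which may
  differ from \<open>a\<close>; the offset \<open>b\<close> records the difference in coordinate
  \<open>j\<close>.\<close>

lemma analytic_on_line:
  fixes f :: "'p::prime_card padic^'n \<Rightarrow> 'p padic^'m"
  assumes "padic_analytic_on D f" "a \<in> D"
  shows "\<exists>r>0. \<exists>c b. \<exists>k :: ('n \<Rightarrow> nat) \<Rightarrow> nat. \<forall>t. padic_norm t < r \<longrightarrow>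
    ((\<lambda>\<alpha>. c \<alpha> * (t + b) ^ k \<alpha>) has_sum f (a + t *s axis j 1) $ i) UNIV"
proof -
  obtain U a0 c where U: "open U" "a \<in> U" and c: "has_power_series_on f a0 c U"
    using assms unfolding padic_analytic_on_def by blast
  have "((\<lambda>t. a + t *s axis j 1) \<longlongrightarrow> a) (nhds 0)"
  proof (rule vec_tendstoI)
    fix l
    have "((\<lambda>t. a $ l + t * axis j 1 $ l) \<longlongrightarrow> a $ l + 0 * axis j 1 $ l) (nhds 0)"
      by (intro tendsto_add tendsto_const tendsto_mult_right filterlim_ident)
    thus "((\<lambda>t. (a + t *s axis j 1) $ l) \<longlongrightarrow> a $ l) (nhds 0)" by simp
  qed
  hence "eventually (\<lambda>t. a + t *s axis j 1 \<in> U) (nhds 0)"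
    using U by (auto dest: topological_tendstoD)
  then obtain r where r: "r > 0" "\<And>t. padic_norm t < r \<Longrightarrow> a + t *s axis j 1 \<in> U"
    by (auto simp: eventually_nhds_metric dist_padic_def)
  define d where "d = (\<lambda>\<alpha>. c \<alpha> $ i * (\<Prod>l\<in>UNIV - {j}. (a $ l - a0 $ l) ^ \<alpha> l))"
  have "((\<lambda>\<alpha>. d \<alpha> * (t + (a $ j - a0 $ j)) ^ \<alpha> j) has_sum f (a + t *s axis j 1) $ i) UNIV"
    if "padic_norm t < r" for t
  proof -
    define x where "x = a + t *s axis j 1"
    have "((\<lambda>\<alpha>. (\<Prod>l\<in>UNIV. (x $ l - a0 $ l) ^ \<alpha> l) *s c \<alpha>) has_sum f x) UNIV"
      using c r(2)[OF that] unfolding has_power_series_on_def x_def by blast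
    hence "((\<lambda>\<alpha>. ((\<Prod>l\<in>UNIV. (x $ l - a0 $ l) ^ \<alpha> l) *s c \<alpha>) $ i) has_sum f x $ i) UNIV"
      unfolding has_sum_def by (auto dest!: tendsto_vec_nth[of _ _ _ i] simp: sum_component)
    moreover have "((\<Prod>l\<in>UNIV. (x $ l - a0 $ l) ^ \<alpha> l) *s c \<alpha>) $ i
        = d \<alpha> * (t + (a $ j - a0 $ j)) ^ \<alpha> j" for \<alpha>
    proof -
      have "(\<Prod>l\<in>UNIV. (x $ l - a0 $ l) ^ \<alpha> l)
          = (x $ j - a0 $ j) ^ \<alpha> j * (\<Prod>l\<in>UNIV - {j}. (x $ l - a0 $ l) ^ \<alpha> l)"
        by (rule prod.remove) auto
      also have "(\<Prod>l\<in>UNIV - {j}. (x $ l - a0 $ l) ^ \<alpha> l)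
          = (\<Prod>l\<in>UNIV - {j}. (a $ l - a0 $ l) ^ \<alpha> l)"
        by (intro prod.cong) (auto simp: x_def axis_def)
      finally show ?thesis by (simp add: d_def x_def axis_def algebra_simps)
    qed
    ultimately show ?thesis by (simp add: x_def)
  qed
  thus ?thesis using r(1)
    by (intro exI[of _ r] exI[of _ d] exI[of _ "a $ j - a0 $ j"] exI[of _ "\<lambda>\<alpha>. \<alpha> j"] conjI allI impI)
qed

lemma affine_has_power_series:
  fixes f :: "'p::prime_card padic^'n \<Rightarrow> 'p padic^'m"
  assumes f: "\<And>x. x \<in> U \<Longrightarrow> f x = f a + (\<Sum>j\<in>UNIV. (x $ j - a $ j) *s L j)"
  shows "\<exists>c. has_power_series_on f a c U"
proof -
  \<comment> \<open>The unit multi-indices. An affine map has nonzero coefficients at most at these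
    and at the zero multi-index, so its series is a finite sum.\<close>
  define \<delta> where "\<delta> = (\<lambda>j::'n. (\<lambda>i::'n. if i = j then 1 else 0 :: nat))"
  define c where "c = (\<lambda>\<alpha>. if \<alpha> = (\<lambda>_. 0) then f a else \<Sum>j\<in>UNIV. if \<alpha> = \<delta> j then L j else 0)"
  have inj: "inj \<delta>" by (intro injI) (auto simp: \<delta>_def fun_eq_iff split: if_splits)
  have nz: "\<delta> j \<noteq> (\<lambda>_. 0)" for j by (auto simp: \<delta>_def fun_eq_iff)
  hence notin: "(\<lambda>_. 0) \<notin> range \<delta>" by (metis rangeE)
  have c\<delta>: "c (\<delta> j) = L j" for j
    using nz[of j] inj by (simp add: c_def inj_eq)
  have "((\<lambda>\<alpha>. (\<Prod>i\<in>UNIV. (x $ i - a $ i) ^ \<alpha> i) *s c \<alpha>) has_sum f x) UNIV" if "x \<in> U" for x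
  proof -
    define g where "g = (\<lambda>\<alpha>. (\<Prod>i\<in>UNIV. (x $ i - a $ i) ^ \<alpha> i) *s c \<alpha>)"
    have "g (\<delta> j) = (x $ j - a $ j) *s L j" for j
    proof -
      have "(\<Prod>i\<in>UNIV. (x $ i - a $ i) ^ \<delta> j i) = (\<Prod>i\<in>UNIV. if i = j then x $ i - a $ i else 1)"
        by (intro prod.cong) (auto simp: \<delta>_def)
      thus ?thesis by (simp add: g_def c\<delta>)
    qed
    hence "sum g (range \<delta>) = (\<Sum>j\<in>UNIV. (x $ j - a $ j) *s L j)"
      using inj by (simp add: sum.reindex)
    moreover have "g (\<lambda>_. 0) = f a" by (simp add: g_def c_def)
    ultimately have "sum g (insert (\<lambda>_. 0) (range \<delta>)) = f x"
      using notin by (subst sum.insert) (auto simp: f[OF that])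
    moreover have "g \<alpha> = 0" if "\<alpha> \<notin> insert (\<lambda>_. 0) (range \<delta>)" for \<alpha>
    proof -
      have "c \<alpha> = 0" using that by (auto simp: c_def intro!: sum.neutral)
      thus ?thesis by (simp add: g_def)
    qed
    hence "(g has_sum f x) UNIV \<longleftrightarrow> (g has_sum f x) (insert (\<lambda>_. 0) (range \<delta>))"
      by (intro has_sum_cong_neutral) auto
    ultimately show ?thesis
      using has_sum_finite[of "insert (\<lambda>_. 0) (range \<delta>)" g] by (simp add: g_def[symmetric])
  qed
  thus ?thesis unfolding has_power_series_on_def by blast
qed

lemma jacobian_locally_affine:
  fixes f :: "'p::prime_card padic^'n \<Rightarrow> 'p padic^'m"
  assumes "r > 0" and "\<And>t. padic_norm t < r \<Longrightarrow> f (a + t *s axis j 1) $ i = f a $ i + t * l"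
  shows "jacobian f a $ i $ j = l"
proof -
  have "eventually (\<lambda>t. (f (a + t *s axis j 1) $ i - f a $ i) / t = l) (at 0)"
    unfolding eventually_at dist_padic_def using assms by (intro exI[of _ r]) auto
  hence "Lim (at 0) (\<lambda>t. (f (a + t *s axis j 1) $ i - f a $ i) / t) = l"
    by (intro tendsto_Lim tendsto_eventually) auto
  thus ?thesis by (simp add: jacobian_def)
qed

lemma padic_analytic_onI:
  assumes "\<And>a. a \<in> D \<Longrightarrow> \<exists>U c. open U \<and> a \<in> U \<and> U \<subseteq> D \<and> has_power_series_on f a c U"
  shows "padic_analytic_on D f"
  unfolding padic_analytic_on_def
proof (intro exI conjI)
  show "\<Union>{U. open U \<and> U \<subseteq> D \<and> (\<exists>a\<in>U. \<exists>c. has_power_series_on f a c U)} = D"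
  proof (intro equalityI subsetI)
    fix a assume "a \<in> D"
    then obtain U c where "open U" "a \<in> U" "U \<subseteq> D" "has_power_series_on f a c U"
      using assms by blast
    thus "a \<in> \<Union>{U. open U \<and> U \<subseteq> D \<and> (\<exists>a\<in>U. \<exists>c. has_power_series_on f a c U)}"
      by (intro UnionI[of U]) auto
  qed blast
qed blast

lemma open_padic_box: "open {x :: 'p::prime_card padic^'n. \<forall>i. padic_norm (x $ i - a $ i) < r}"
proof -
  have "open (\<Inter>i. (\<lambda>x. x $ i) -` ball (a $ i) r)"
    by (intro open_INT open_vimage_vec_nth ballI) auto
  also have "(\<Inter>i. (\<lambda>x. x $ i) -` ball (a $ i) r) = {x. \<forall>i. padic_norm (x $ i - a $ i) < r}"
    by (auto simp: dist_padic_def padic_norm_commute)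
  finally show ?thesis .
qed

lemma differential_coordinate: "differential (\<lambda>x :: 'p::prime_card padic^'n. x $ i) a v = v $ i"
proof -
  have "jacobian (\<lambda>x :: 'p padic^'n. vec (x $ i) :: 'p padic^1) a $ 1 $ j = axis j 1 $ i" for j
    by (rule jacobian_locally_affine[where r = 1]) simp_all
  hence "differential (\<lambda>x. x $ i) a v = (\<Sum>j\<in>UNIV. axis j 1 $ i * v $ j)"
    by (simp add: differential_def pushforward_def matrix_vector_mult_def)
  also have "\<dots> = (\<Sum>j\<in>UNIV. if i = j then v $ j else 0)"
    by (intro sum.cong) (auto simp: axis_def)
  finally show ?thesis by simp
qed

section \<open>The baker's map\<close>

text \<open>The digit \<open>d(x)\<close>. No particular digit system is fixed; in particular
  \<open>residue 0\<close> may be nonzero.\<close>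

definition residue :: "'p::prime_card padic \<Rightarrow> 'p padic" where
  "residue x = (SOME w. padic_norm (x - w) < 1)"

lemma residue_close: "padic_norm (x - residue x) < 1"
  unfolding residue_def by (rule someI[of _ x]) simp

text \<open>Congruent points admit the same representatives, so the choice is made from one and the
  same predicate.\<close>

lemma residue_cong:
  assumes "padic_norm (x - y) < 1" shows "residue x = residue y"
proof -
  have "padic_norm (x - w) < 1 \<longleftrightarrow> padic_norm (y - w) < 1" for w
    using padic_norm_diff_trans[of x w y] padic_norm_diff_trans[of y w x] assms
      padic_norm_commute[of x y] by auto
  thus ?thesis by (simp add: residue_def)
qed

lemma residue_in_padic_int:
  assumes "x \<in> padic_int" shows "residue x \<in> padic_int"
proof -
  have "x - residue x \<in> padic_int" using residue_close[of x] by (simp add: padic_int_def)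
  from padic_int_closed(2)[OF assms this] show ?thesis by simp
qed

lemma padic_vec2_eqI: "m $ 1 = m' $ 1 \<Longrightarrow> m $ 2 = m' $ 2 \<Longrightarrow> m = (m' :: 'p::prime_card padic^2)"
  by (simp add: vec_eq_iff forall_2)

definition baker :: "'p::prime_card padic^2 \<Rightarrow> 'p padic^2" where
  "baker m = vector [uniformizer * m $ 1 + residue (m $ 2), (m $ 2 - residue (m $ 2)) / uniformizer]"

text \<open>The formula of \<open>baker\<close> with the coordinates exchanged: the lowest digit of
  the first coordinate returns to the second.\<close>

definition unbaker :: "'p::prime_card padic^2 \<Rightarrow> 'p padic^2" where
  "unbaker m = vector [(m $ 1 - residue (m $ 1)) / uniformizer, uniformizer * m $ 2 + residue (m $ 1)]"

lemma uniformizer_in_padic_int: "uniformizer \<in> padic_int"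
  using uniformizer_power_in_padic_int[of 1] by simp

lemma zero_in_plane: "0 \<in> padic_int_plane"
  by (simp add: padic_int_plane_def)

lemma baker_in_plane: "m \<in> padic_int_plane \<Longrightarrow> baker m \<in> padic_int_plane"
  by (auto simp: baker_def padic_int_plane_def
      intro!: padic_int_closed uniformizer_in_padic_int residue_in_padic_int
        divide_uniformizer_in_padic_int residue_close)

lemma unbaker_in_plane: "m \<in> padic_int_plane \<Longrightarrow> unbaker m \<in> padic_int_plane"
  by (auto simp: unbaker_def padic_int_plane_def
      intro!: padic_int_closed uniformizer_in_padic_int residue_in_padic_int
        divide_uniformizer_in_padic_int residue_close)

text \<open>The argument on the left is congruent to \<open>y\<close> modulo p. This is how the
  inverse map recovers the digit that was moved.\<close>

lemma residue_uniformizer_mult_add_residue: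
  assumes "x \<in> padic_int"
  shows "residue (uniformizer * x + residue y) = residue y"
proof -
  have "padic_norm (uniformizer * x + residue y - y) < 1"
    using padic_norm_ultra_diff[of "uniformizer * x" "y - residue y"] residue_close[of y]
      padic_norm_uniformizer_mult_less_1[OF assms] by (simp add: algebra_simps)
  thus ?thesis by (rule residue_cong)
qed

lemma unbaker_baker: "m \<in> padic_int_plane \<Longrightarrow> unbaker (baker m) = m"
  by (rule padic_vec2_eqI)
    (simp_all add: baker_def unbaker_def padic_int_plane_def residue_uniformizer_mult_add_residue)

lemma baker_unbaker: "m \<in> padic_int_plane \<Longrightarrow> baker (unbaker m) = m"
  by (rule padic_vec2_eqI)
    (simp_all add: baker_def unbaker_def padic_int_plane_def residue_uniformizer_mult_add_residue)

lemma funpow_baker_in_plane: "m \<in> padic_int_plane \<Longrightarrow> (baker ^^ n) m \<in> padic_int_plane"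
  by (induction n) (simp_all add: baker_in_plane)

lemma funpow_unbaker_in_plane: "m \<in> padic_int_plane \<Longrightarrow> (unbaker ^^ n) m \<in> padic_int_plane"
  by (induction n) (simp_all add: unbaker_in_plane)

lemma funpow_left_inverse:
  assumes "\<And>x. x \<in> A \<Longrightarrow> f x \<in> A" "\<And>x. x \<in> A \<Longrightarrow> g (f x) = x" "x \<in> A"
  shows "(g ^^ n) ((f ^^ n) x) = x"
proof (induction n)
  case (Suc n)
  have "(f ^^ n) x \<in> A" by (induction n) (simp_all add: assms)
  hence "(g ^^ Suc n) ((f ^^ Suc n) x) = (g ^^ n) ((f ^^ n) x)"
    unfolding funpow_Suc_right[of n g] by (simp add: assms)
  thus ?case using Suc by simp
qed simp

lemma funpow_unbaker_baker: "m \<in> padic_int_plane \<Longrightarrow> (unbaker ^^ n) ((baker ^^ n) m) = m"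
  by (rule funpow_left_inverse[OF baker_in_plane unbaker_baker])

lemma funpow_baker_unbaker: "m \<in> padic_int_plane \<Longrightarrow> (baker ^^ n) ((unbaker ^^ n) m) = m"
  by (rule funpow_left_inverse[OF unbaker_in_plane baker_unbaker])

section \<open>The baker's map and small translations\<close>

text \<open>A vertical shift of norm below 1 leaves the lowest digit unchanged, and on points with a
  common digit the map is affine with linear part diag(p, 1/p).\<close>

lemma baker_translate:
  assumes "padic_norm v < 1"
  shows "baker (m + vector [u, v]) = baker m + vector [uniformizer * u, v / uniformizer]"
proof -
  have "residue (m $ 2 + v) = residue (m $ 2)" using assms by (intro residue_cong) simp
  thus ?thesis
    by (intro padic_vec2_eqI) (simp_all add: baker_def algebra_simps diff_divide_distrib add_divide_distrib)
qed

text \<open>Each application enlarges the vertical shift by the factor p in norm; the hypothesis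
  keeps it below 1 before each of the \<open>n\<close> applications.\<close>

lemma funpow_baker_translate:
  fixes m :: "'p::prime_card padic^2"
  assumes "padic_norm v \<le> (1 / real CARD('p)) ^ n"
  shows "(baker ^^ n) (m + vector [u, v])
    = (baker ^^ n) m + vector [uniformizer ^ n * u, v / uniformizer ^ n]"
  using assms
proof (induction n)
  case 0
  show ?case by (rule padic_vec2_eqI) simp_all
next
  case (Suc n)
  have q: "0 < 1 / real CARD('p)" "1 / real CARD('p) < 1" using prime_card_gt_1[where 'p='p] by auto
  have "padic_norm (v / uniformizer ^ n) \<le> 1 / real CARD('p)"
    unfolding padic_norm_divide padic_norm_uniformizer_power
    using Suc.prems q by (subst pos_divide_le_eq) auto
  hence less: "padic_norm (v / uniformizer ^ n) < 1" using q(2) by (rule le_less_trans)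
  have "(1 / real CARD('p)) ^ Suc n \<le> (1 / real CARD('p)) ^ n"
    using q by (intro power_decreasing) auto
  hence "padic_norm v \<le> (1 / real CARD('p)) ^ n" using Suc.prems by linarith
  from Suc.IH[OF this] show ?case
    by (simp add: baker_translate[OF less] mult_ac)
qed

lemma funpow_baker_translate_horizontal:
  "(baker ^^ n) (m + vector [u, 0]) = (baker ^^ n) m + vector [uniformizer ^ n * u, 0]"
  using funpow_baker_translate[of 0 n m u] by simp

section \<open>The action\<close>

text \<open>The baker's map sends the horizontal translation by \<open>a\<close> to the one by \<open>p a\<close>, so that the
  right-hand side would be the same for every \<open>n\<close> with \<open>p\<^sup>n g\<close> integral.\<close>

definition baker_action :: "'p::prime_card padic \<Rightarrow> 'p padic^2 \<Rightarrow> 'p padic^2" where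
  "baker_action g m = (let n = (LEAST n. uniformizer ^ n * g \<in> padic_int)
    in (unbaker ^^ n) ((baker ^^ n) m + vector [uniformizer ^ n * g, 0]))"

lemma translate_horizontal_in_plane:
  "m \<in> padic_int_plane \<Longrightarrow> u \<in> padic_int \<Longrightarrow> m + vector [u, 0] \<in> padic_int_plane"
  by (simp add: padic_int_plane_def padic_int_closed)

text \<open>This frees the action from the least exponent \<open>k\<close> of its definition: an
  admissible \<open>n\<close> is at least \<open>k\<close>, and the remaining applications of
  \<open>baker\<close> stretch the translation by \<open>uniformizer ^ k * g\<close> to the one by
  \<open>uniformizer ^ n * g\<close>.\<close>

lemma
  assumes m: "m \<in> padic_int_plane"
  shows baker_action_in_plane: "baker_action g m \<in> padic_int_plane"
    and funpow_baker_baker_action: "uniformizer ^ n * g \<in> padic_int \<Longrightarrow>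
      (baker ^^ n) (baker_action g m) = (baker ^^ n) m + vector [uniformizer ^ n * g, 0]"
proof -
  define k where "k = (LEAST n. uniformizer ^ n * g \<in> padic_int)"
  have k: "uniformizer ^ k * g \<in> padic_int"
    unfolding k_def by (rule LeastI_ex[OF exists_uniformizer_power_mult_in_padic_int])
  define z where "z = (baker ^^ k) m + vector [uniformizer ^ k * g, 0]"
  have z: "z \<in> padic_int_plane"
    unfolding z_def by (intro translate_horizontal_in_plane funpow_baker_in_plane m k)
  have eq: "baker_action g m = (unbaker ^^ k) z"
    by (simp add: baker_action_def Let_def k_def z_def)
  show "baker_action g m \<in> padic_int_plane" unfolding eq by (rule funpow_unbaker_in_plane[OF z])
  assume "uniformizer ^ n * g \<in> padic_int"
  hence "k \<le> n" unfolding k_def by (rule Least_le)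
  then obtain l where n: "n = l + k" using le_Suc_ex[of k n] by (auto simp: add.commute)
  have "(baker ^^ n) (baker_action g m) = (baker ^^ l) z"
    by (simp add: n funpow_add eq funpow_baker_unbaker z)
  also have "\<dots> = (baker ^^ n) m + vector [uniformizer ^ n * g, 0]"
    by (simp add: z_def funpow_baker_translate_horizontal n funpow_add power_add mult.assoc)
  finally show "(baker ^^ n) (baker_action g m) = (baker ^^ n) m + vector [uniformizer ^ n * g, 0]" .
qed

text \<open>The iterates of \<open>baker\<close> are injective on the plane, so an identity for the
  action can be checked after applying them, where the action is a translation.\<close>

lemma baker_action_eqI:
  assumes "m \<in> padic_int_plane" "m' \<in> padic_int_plane" "uniformizer ^ n * g \<in> padic_int"
    and "(baker ^^ n) m' = (baker ^^ n) m + vector [uniformizer ^ n * g, 0]"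
  shows "baker_action g m = m'"
  using assms by (metis baker_action_in_plane funpow_baker_baker_action funpow_unbaker_baker)

lemma vector_pair_0 [simp]: "vector [0, 0] = (0 :: 'p::prime_card padic^2)"
  by (rule padic_vec2_eqI) simp_all

lemma vector_pair_add: "vector [u, v] + vector [u', v'] = (vector [u + u', v + v'] :: 'p::prime_card padic^2)"
  by (rule padic_vec2_eqI) simp_all

lemma baker_action_0: "m \<in> padic_int_plane \<Longrightarrow> baker_action 0 m = m"
  by (rule baker_action_eqI[where n = 0]) simp_all

text \<open>With an exponent that makes both \<open>g\<close> and \<open>h\<close> integral, both
  act as horizontal translations after conjugation, and these add.\<close>

lemma baker_action_add:
  assumes m: "m \<in> padic_int_plane"
  shows "baker_action (g + h) m = baker_action g (baker_action h m)"
proof -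
  obtain i j where "uniformizer ^ i * g \<in> padic_int" "uniformizer ^ j * h \<in> padic_int"
    using exists_uniformizer_power_mult_in_padic_int by blast
  then obtain n where n: "uniformizer ^ n * g \<in> padic_int" "uniformizer ^ n * h \<in> padic_int"
    using uniformizer_power_mult_in_padic_int_mono[of i g "max i j"]
      uniformizer_power_mult_in_padic_int_mono[of j h "max i j"] by auto
  show ?thesis
  proof (rule baker_action_eqI[OF m, where n = n])
    show "uniformizer ^ n * (g + h) \<in> padic_int"
      using padic_int_closed(1)[OF n] by (simp add: distrib_left)
    show "(baker ^^ n) (baker_action g (baker_action h m))
        = (baker ^^ n) m + vector [uniformizer ^ n * (g + h), 0]"
      by (simp add: funpow_baker_baker_action baker_action_in_plane m n add.assoc vector_pair_add
          distrib_left add.commute)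
  qed (intro baker_action_in_plane m)
qed

lemma baker_action_free:
  assumes m: "m \<in> padic_int_plane" and eq: "baker_action g m = m"
  shows "g = 0"
proof -
  obtain n where n: "uniformizer ^ n * g \<in> padic_int"
    using exists_uniformizer_power_mult_in_padic_int by blast
  have "vector [uniformizer ^ n * g, 0] = (0 :: 'a padic^2)"
    using funpow_baker_baker_action[OF m n] eq by simp
  hence "(vector [uniformizer ^ n * g, 0] :: 'a padic^2) $ 1 = 0" by (simp only: zero_index)
  thus ?thesis by simp
qed

text \<open>After \<open>n\<close> applications of \<open>baker\<close> the perturbation of the
  point is again a shift, which commutes with the translation by the group element; an integral
  \<open>t\<close> admits the same exponent as \<open>g\<close>.\<close>

lemma baker_action_locally_translation:
  fixes m :: "'p::prime_card padic^2"
  assumes m: "m \<in> padic_int_plane" and g: "uniformizer ^ n * g \<in> padic_int"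
    and t: "t \<in> padic_int" and u: "u \<in> padic_int"
    and v: "padic_norm v \<le> (1 / real CARD('p)) ^ n"
  shows "baker_action (g + t) (m + vector [u, v]) = baker_action g m + vector [u + t, v]"
proof (rule baker_action_eqI[where n = n])
  have "(1 / real CARD('p)) ^ n \<le> 1"
    using prime_card_gt_1[where 'p='p] by (intro power_le_one) auto
  hence v1: "v \<in> padic_int" using v by (simp add: padic_int_def)
  show "m + vector [u, v] \<in> padic_int_plane"
    using m u v1 by (simp add: padic_int_plane_def padic_int_closed)
  show "baker_action g m + vector [u + t, v] \<in> padic_int_plane"
    using baker_action_in_plane[OF m, of g] u t v1 by (simp add: padic_int_plane_def padic_int_closed)
  show "uniformizer ^ n * (g + t) \<in> padic_int"
    unfolding distrib_left by (intro padic_int_closed(1,3) g t uniformizer_power_in_padic_int)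
  show "(baker ^^ n) (baker_action g m + vector [u + t, v])
      = (baker ^^ n) (m + vector [u, v]) + vector [uniformizer ^ n * (g + t), 0]"
    unfolding funpow_baker_translate[OF v] funpow_baker_baker_action[OF m g] add.assoc vector_pair_add
    by (simp add: algebra_simps)
qed

lemma baker_action_translation_nbhd:
  fixes m :: "'p::prime_card padic^2"
  assumes "m \<in> padic_int_plane"
  obtains r where "r > 0" "r \<le> 1"
    "\<And>t u v. padic_norm t < r \<Longrightarrow> padic_norm u < r \<Longrightarrow> padic_norm v < r \<Longrightarrow>
      baker_action (g + t) (m + vector [u, v]) = baker_action g m + vector [u + t, v]"
proof -
  obtain n where n: "uniformizer ^ n * g \<in> padic_int"
    using exists_uniformizer_power_mult_in_padic_int by blast
  have q: "0 < (1 / real CARD('p)) ^ n" "(1 / real CARD('p)) ^ n \<le> 1"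
    using prime_card_gt_1[where 'p='p] by (auto intro!: power_le_one)
  show thesis
  proof (rule that[OF q])
    fix t u v :: "'p padic"
    assume "padic_norm t < (1 / real CARD('p)) ^ n" "padic_norm u < (1 / real CARD('p)) ^ n"
      "padic_norm v < (1 / real CARD('p)) ^ n"
    thus "baker_action (g + t) (m + vector [u, v]) = baker_action g m + vector [u + t, v]"
      using q by (intro baker_action_locally_translation[OF assms n]) (auto simp: padic_int_def)
  qed
qed

text \<open>Changing the vertical digit number \<open>n\<close> of the origin is realized by the action: one more
  application of the baker's map turns it into a horizontal digit.\<close>

lemma baker_action_returns:
  obtains g t :: "'p::prime_card padic" where
    "padic_norm g = real CARD('p) ^ Suc n" "padic_norm t = (1 / real CARD('p)) ^ n"
    "baker_action g 0 = vector [0, t]"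
proof -
  \<comment> \<open>The origin need not be fixed by \<open>baker\<close>, because
    \<open>residue 0\<close> may be nonzero.\<close>
  define z where "z = (baker ^^ n) (0 :: 'p padic^2)"
  define c where "c = residue (z $ 2)"
  \<comment> \<open>As \<open>c + 1\<close> is not congruent to \<open>c\<close>, the digits
    \<open>w\<close> and \<open>c\<close> differ by a unit. Adding \<open>t\<close> replaces the
    digit \<open>c\<close>, in vertical position \<open>n\<close>, by \<open>w\<close>; after one
    more application this is the horizontal translation by \<open>w - c\<close>, which determines
    \<open>g\<close>.\<close>
  define w where "w = residue (c + 1)"
  define t where "t = uniformizer ^ n * (w - c)"
  define g where "g = (w - c) / uniformizer ^ Suc n"
  have near: "padic_norm (c + 1 - w) < 1" unfolding w_def by (rule residue_close)
  have norm: "padic_norm (w - c) = 1"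
  proof (rule antisym)
    show "padic_norm (w - c) \<le> 1" using padic_norm_ultra_diff[of 1 "c + 1 - w"] near by simp
    show "1 \<le> padic_norm (w - c)" using padic_norm_ultra[of "c + 1 - w" "w - c"] near by auto
  qed
  have t: "padic_norm t = (1 / real CARD('p)) ^ n"
    by (simp add: t_def padic_norm_mult norm padic_norm_uniformizer_power)
  hence t1: "t \<in> padic_int"
    using prime_card_gt_1[where 'p='p] by (auto simp: padic_int_def intro!: power_le_one)
  have gn: "uniformizer ^ Suc n * g = w - c" by (simp add: g_def)
  have "padic_norm (z $ 2 + (w - c) - (c + 1)) < 1"
    using padic_norm_ultra_diff[of "z $ 2 - c" "c + 1 - w"] near residue_close[of "z $ 2"]
    by (simp add: c_def algebra_simps)
  hence res: "residue (z $ 2 + (w - c)) = w" unfolding w_def by (rule residue_cong)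
  have "(baker ^^ Suc n) (vector [0, t]) = baker ((baker ^^ n) (0 + vector [0, t]))" by simp
  also have "\<dots> = baker (z + vector [0, w - c])"
    by (subst funpow_baker_translate) (simp_all add: t[unfolded t_def] z_def t_def)
  \<comment> \<open>The new digit is removed together with the shift, so the second coordinates
    agree and only the digit moved to the first coordinate differs.\<close>
  also have "\<dots> = baker z + vector [w - c, 0]"
  proof (rule padic_vec2_eqI)
    have "z $ 2 + (w - c) - w = z $ 2 - c" by simp
    thus "baker (z + vector [0, w - c]) $ 2 = (baker z + vector [w - c, 0]) $ 2"
      by (simp add: baker_def res c_def[symmetric] del: add_diff_cancel_left' add_diff_eq)
  qed (simp add: baker_def res c_def[symmetric])
  also have "\<dots> = (baker ^^ Suc n) 0 + vector [uniformizer ^ Suc n * g, 0]"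
    unfolding gn by (simp add: z_def)
  finally have "baker_action g 0 = vector [0, t]"
    using norm t1
    by (intro baker_action_eqI[OF zero_in_plane, where n = "Suc n"])
      (auto simp: padic_int_plane_def padic_int_def gn simp del: power_Suc funpow.simps)
  moreover have "padic_norm g = real CARD('p) ^ Suc n"
    unfolding g_def padic_norm_divide padic_norm_uniformizer_power norm by (simp add: field_simps)
  ultimately show thesis using t that by blast
qed

lemma baker_action_returning_sequence:
  obtains g T :: "nat \<Rightarrow> 'p::prime_card padic" where
    "\<And>n. padic_norm (g n) = real CARD('p) ^ Suc n" "T \<longlonglongrightarrow> 0" "\<And>n. T n \<noteq> 0"
    "\<And>n. baker_action (g n) 0 = vector [0, T n]"
proof -
  have "\<exists>g t :: 'p padic. padic_norm g = real CARD('p) ^ Suc n \<and>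
      padic_norm t = (1 / real CARD('p)) ^ n \<and> baker_action g 0 = vector [0, t]" for n
    by (rule baker_action_returns[of n]) blast
  then obtain g T :: "nat \<Rightarrow> 'p padic" where gT: "\<And>n. padic_norm (g n) = real CARD('p) ^ Suc n"
    "\<And>n. padic_norm (T n) = (1 / real CARD('p)) ^ n" "\<And>n. baker_action (g n) 0 = vector [0, T n]"
    by metis
  have "(\<lambda>n. (1 / real CARD('p)) ^ n) \<longlonglongrightarrow> 0"
    using prime_card_gt_1[where 'p='p] by (intro LIMSEQ_power_zero) simp
  hence "T \<longlonglongrightarrow> 0" by (subst tendsto_dist_iff) (simp add: dist_padic_def gT)
  moreover have "T n \<noteq> 0" for n
    using gT(2)[of n] by auto
  ultimately show thesis using that gT by blast
qed

section \<open>Analyticity, symplectic invariance and generator of the action\<close>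

lemma baker_action_analytic:
  "padic_analytic_on {v :: 'p::prime_card padic^3. vector [v $ 2, v $ 3] \<in> padic_int_plane}
    (\<lambda>v. baker_action (v $ 1) (vector [v $ 2, v $ 3]))"
    (is "padic_analytic_on ?D ?f")
proof (rule padic_analytic_onI)
  fix a :: "'p padic^3" assume a: "a \<in> ?D"
  define m where "m = (vector [a $ 2, a $ 3] :: 'p padic^2)"
  obtain r where r: "r > 0" "r \<le> 1"
    and local: "\<And>t u v. padic_norm t < r \<Longrightarrow> padic_norm u < r \<Longrightarrow> padic_norm v < r \<Longrightarrow>
      baker_action (a $ 1 + t) (m + vector [u, v]) = baker_action (a $ 1) m + vector [u + t, v]"
    using a baker_action_translation_nbhd[of m "a $ 1"] unfolding m_def by blast
  define U where "U = {x. \<forall>i. padic_norm (x $ i - a $ i) < r}"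
  \<comment> \<open>The partial derivatives with respect to g, x and y of the local form (x + g,
    y).\<close>
  define L where "L = (vector [vector [1, 0], vector [1, 0], vector [0, 1]] :: 'p padic^2^3)"
  have "?f x = ?f a + (\<Sum>j\<in>UNIV. (x $ j - a $ j) *s L $ j)" if "x \<in> U" for x
  proof -
    have "vector [x $ 2, x $ 3] = m + vector [x $ 2 - a $ 2, x $ 3 - a $ 3]"
      by (rule padic_vec2_eqI) (simp_all add: m_def)
    moreover have "baker_action (a $ 1 + (x $ 1 - a $ 1)) (m + vector [x $ 2 - a $ 2, x $ 3 - a $ 3])
        = baker_action (a $ 1) m + vector [(x $ 2 - a $ 2) + (x $ 1 - a $ 1), x $ 3 - a $ 3]"
      using that by (intro local) (simp_all add: U_def)
    ultimately have "?f x = ?f a + vector [(x $ 2 - a $ 2) + (x $ 1 - a $ 1), x $ 3 - a $ 3]"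
      by (simp add: m_def)
    also have "vector [(x $ 2 - a $ 2) + (x $ 1 - a $ 1), x $ 3 - a $ 3]
        = (\<Sum>j\<in>UNIV. (x $ j - a $ j) *s L $ j)"
      by (rule padic_vec2_eqI) (simp_all add: sum_3 L_def)
    finally show ?thesis .
  qed
  hence "\<exists>c. has_power_series_on ?f a c U" by (rule affine_has_power_series)
  moreover have "U \<subseteq> ?D"
  proof
    fix x assume x: "x \<in> U"
    have "x $ i \<in> padic_int" if "a $ i \<in> padic_int" for i
    proof -
      have "x $ i - a $ i \<in> padic_int"
        using x less_le_trans[OF _ r(2)] by (simp add: U_def padic_int_def less_imp_le)
      from padic_int_closed(1)[OF this that] show ?thesis by simp
    qed
    thus "x \<in> ?D" using a by (simp add: padic_int_plane_def)
  qed
  moreover have "open U" unfolding U_def by (rule open_padic_box)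
  moreover have "a \<in> U" using r by (simp add: U_def)
  ultimately show "\<exists>U c. open U \<and> a \<in> U \<and> U \<subseteq> ?D \<and> has_power_series_on ?f a c U" by blast
qed

lemma scaled_axis_pair:
  "t *s axis 1 1 = (vector [t, 0] :: 'p::prime_card padic^2)"
  "t *s axis 2 1 = (vector [0, t] :: 'p::prime_card padic^2)"
  by (rule padic_vec2_eqI; simp add: axis_def)+

text \<open>For fixed \<open>g\<close> the action is locally a translation, hence has identity
  Jacobian and preserves the constant form.\<close>

lemma pushforward_baker_action:
  assumes m: "m \<in> padic_int_plane"
  shows "pushforward (baker_action g) m v = v"
proof -
  obtain r where r: "r > 0"
    and local: "\<And>t u v. padic_norm t < r \<Longrightarrow> padic_norm u < r \<Longrightarrow> padic_norm v < r \<Longrightarrow>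
      baker_action (g + t) (m + vector [u, v]) = baker_action g m + vector [u + t, v]"
    by (rule baker_action_translation_nbhd[OF m]) blast
  have shift: "baker_action g (m + t *s axis j 1) = baker_action g m + t *s axis j 1"
    if "padic_norm t < r" for t j
    using exhaust_2[of j] local[of 0 t 0] local[of 0 0 t] that r
    by (auto simp: scaled_axis_pair)
  have "jacobian (baker_action g) m $ i $ j = axis j 1 $ i" for i j
    by (rule jacobian_locally_affine[OF r]) (simp add: shift)
  hence "jacobian (baker_action g) m = mat 1"
    by (simp add: vec_eq_iff axis_def mat_def)
  thus ?thesis by (simp add: pushforward_def)
qed

lemma dx_dy_eq: "dx_dy m u v = u $ 1 * v $ 2 - v $ 1 * u $ 2"
  by (simp add: dx_dy_def wedge_def differential_coordinate)

lemma baker_action_symplectic: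
  "analytic_symplectic_action padic_int_plane dx_dy baker_action"
  unfolding analytic_symplectic_action_def pullback_def
  by (auto simp: baker_action_in_plane baker_action_0 baker_action_add baker_action_analytic
      pushforward_baker_action dx_dy_eq)

text \<open>Small group elements act as horizontal translations, so the generator is d/dx everywhere
  although whole orbits are not horizontal.\<close>

lemma infinitesimal_baker_action:
  fixes m :: "'p::prime_card padic^2"
  assumes m: "m \<in> padic_int_plane"
  shows "infinitesimal_action baker_action \<xi> m = vector [\<xi>, 0]"
proof -
  obtain r where r: "r > 0"
    and local: "\<And>t u v. padic_norm t < r \<Longrightarrow> padic_norm u < r \<Longrightarrow> padic_norm v < r \<Longrightarrow>
      baker_action (0 + t) (m + vector [u, v]) = baker_action 0 m + vector [u + t, v]"
    by (rule baker_action_translation_nbhd[OF m]) blast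
  have "baker_action t m = baker_action 0 m + vector [t, 0]" if "padic_norm t < r" for t
    using local[of t 0 0] that r by simp
  moreover have "vector [t, 0] $ i = t * (vector [1, 0] :: 'p padic^2) $ i" for t i
    using exhaust_2[of i] by auto
  ultimately have val: "baker_action t m $ i = baker_action 0 m $ i + t * (vector [1, 0] :: 'p padic^2) $ i"
    if "padic_norm t < r" for t i
    using that by (metis vector_add_component)
  have "jacobian (\<lambda>g :: 'p padic^1. baker_action (g $ 1) m) 0 $ i $ j
      = (vector [1, 0] :: 'p padic^2) $ i" for i j
  proof (rule jacobian_locally_affine[OF r])
    fix t :: "'p padic" assume t: "padic_norm t < r"
    have "(0 + t *s axis j 1 :: 'p padic^1) $ 1 = t" by (simp add: axis_def)
    thus "baker_action ((0 + t *s axis j 1 :: 'p padic^1) $ 1) m $ i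
        = baker_action ((0 :: 'p padic^1) $ 1) m $ i + t * (vector [1, 0] :: 'p padic^2) $ i"
      using val[OF t, of i] by (simp only: zero_index)
  qed
  thus ?thesis
    by (intro padic_vec2_eqI)
      (simp_all add: infinitesimal_action_def pushforward_def matrix_vector_mult_def)
qed

section \<open>Failure of properness and of the Hamiltonian property\<close>

text \<open>The constant sequence at the origin is moved by \<open>g n\<close> to points converging
  to the origin, while every subsequence of \<open>g\<close> is unbounded.\<close>

lemma baker_action_not_proper:
  "\<not> proper_action padic_int_plane (baker_action :: 'p::prime_card action)"
proof
  assume "proper_action padic_int_plane (baker_action :: 'p action)"
  hence proper: "\<exists>r. strict_mono r \<and> convergent (g \<circ> r)"
    if "\<And>i :: nat. m i \<in> padic_int_plane" "\<exists>l\<in>padic_int_plane. m \<longlonglongrightarrow> l"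
      "\<exists>l\<in>padic_int_plane. (\<lambda>i. baker_action (g i) (m i)) \<longlonglongrightarrow> l"
    for m :: "nat \<Rightarrow> 'p padic^2" and g
    using that unfolding proper_action_def by blast
  obtain g T :: "nat \<Rightarrow> 'p padic" where gT:
    "\<And>n. padic_norm (g n) = real CARD('p) ^ Suc n" "T \<longlonglongrightarrow> 0"
    "\<And>n. baker_action (g n) 0 = vector [0, T n]"
    by (rule baker_action_returning_sequence) blast
  have "(\<lambda>n. vector [0, T n] :: 'p padic^2) \<longlonglongrightarrow> 0"
  proof (rule vec_tendstoI)
    show "(\<lambda>n. (vector [0, T n] :: 'p padic^2) $ i) \<longlonglongrightarrow> 0 $ i" for i
      using exhaust_2[of i] gT(2) by auto
  qed
  hence "\<exists>r. strict_mono r \<and> convergent (g \<circ> r)"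
    using zero_in_plane gT(3) by (intro proper[of "\<lambda>_. 0"]) auto
  then obtain r l where r: "strict_mono r" "(g \<circ> r) \<longlonglongrightarrow> l" by (auto simp: convergent_def)
  obtain N where N: "\<And>n. n \<ge> N \<Longrightarrow> padic_norm (g (r n) - l) < 1"
    using tendstoD[OF r(2), of 1] by (auto simp: eventually_sequentially dist_padic_def)
  \<comment> \<open>From \<open>N\<close> on, the ultrametric inequality bounds the subsequence by
    \<open>max 1 (padic_norm l)\<close>. The exponent \<open>k\<close> exceeds this bound, and
    \<open>n \<le> r n\<close> makes the exponent at index \<open>r n\<close> at least
    \<open>k\<close>.\<close>
  obtain k where k: "max 1 (padic_norm l) < real CARD('p) ^ k"
    using real_arch_pow prime_card_gt_1 by blast
  define n where "n = max N k"
  have "k \<le> Suc (r n)" using seq_suble[OF r(1), of n] by (simp add: n_def)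
  hence "real CARD('p) ^ k \<le> padic_norm (g (r n))"
    unfolding gT using prime_card_gt_1[where 'p='p] by (intro power_increasing) auto
  moreover have "padic_norm (g (r n)) \<le> max 1 (padic_norm l)"
    using padic_norm_ultra[of "g (r n) - l" l] N[of n] by (auto simp: n_def)
  ultimately show False using k by linarith
qed

lemma baker_action_not_hamiltonian:
  "\<not> hamiltonian_action padic_int_plane dx_dy (baker_action :: 'p::prime_card action)"
proof
  assume "hamiltonian_action padic_int_plane dx_dy (baker_action :: 'p action)"
  then obtain \<mu> :: "'p padic^2 \<Rightarrow> 'p padic \<Rightarrow> 'p padic" where
    \<mu>: "momentum_map padic_int_plane dx_dy baker_action \<mu>"
    and inv: "\<And>g m. m \<in> padic_int_plane \<Longrightarrow> \<mu> (baker_action g m) = \<mu> m"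
    unfolding hamiltonian_action_def by blast
  define F where "F = (\<lambda>m. vec (\<mu> m 1) :: 'p padic^1)"
  \<comment> \<open>The momentum coordinate along the vertical line through the origin; its
    difference quotients are those of \<open>jacobian F 0 $ 1 $ 2\<close>.\<close>
  define f where "f = (\<lambda>t. F (0 + t *s axis 2 1) $ 1)"
  have F: "padic_analytic_on padic_int_plane F" using \<mu> by (simp add: momentum_map_def F_def)
  have "\<exists>r>0. \<exists>c b. \<exists>k :: (2 \<Rightarrow> nat) \<Rightarrow> nat. \<forall>t. padic_norm t < r \<longrightarrow>
      ((\<lambda>\<alpha>. c \<alpha> * (t + b) ^ k \<alpha>) has_sum f t) UNIV"
    unfolding f_def by (rule analytic_on_line[OF F zero_in_plane])
  then obtain r c b and k :: "(2 \<Rightarrow> nat) \<Rightarrow> nat" where r: "r > 0"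
    and f: "\<forall>t. padic_norm t < r \<longrightarrow> ((\<lambda>\<alpha>. c \<alpha> * (t + b) ^ k \<alpha>) has_sum f t) UNIV"
    by (elim exE conjE)
  obtain g T :: "nat \<Rightarrow> 'p padic" where T: "T \<longlonglongrightarrow> 0" "\<And>n. T n \<noteq> 0"
    and gT: "\<And>n. baker_action (g n) 0 = vector [0, T n]"
    by (rule baker_action_returning_sequence) blast
  \<comment> \<open>The point with coordinates 0 and \<open>T n\<close> lies in the orbit of the
    origin.\<close>
  have "f (T n) = f 0" for n
    using inv[OF zero_in_plane, of "g n"] by (simp add: f_def F_def gT scaled_axis_pair)
  hence "((\<lambda>t. (f t - f 0) / t) \<longlongrightarrow> 0) (at 0)"
    using f by (intro power_series_deriv_0_if_returning[OF r _ T]) auto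
  hence "Lim (at 0) (\<lambda>t. (f t - f 0) / t) = 0" by (intro tendsto_Lim) simp_all
  hence "jacobian F 0 $ 1 $ 2 = 0" by (simp add: jacobian_def f_def)
  hence "differential (\<lambda>m. \<mu> m 1) 0 (vector [0, 1]) = 0"
    by (simp add: differential_def pushforward_def matrix_vector_mult_def sum_2 F_def)
  \<comment> \<open>The left side pairs the generator d/dx with d/dy and equals 1.\<close>
  moreover have "dx_dy 0 (infinitesimal_action baker_action 1 0) (vector [0, 1])
      = differential (\<lambda>m. \<mu> m 1) 0 (vector [0, 1])"
    using \<mu> by (simp add: momentum_map_def zero_in_plane)
  ultimately show False by (simp add: dx_dy_eq infinitesimal_baker_action[OF zero_in_plane])
qed

theorem theorem3:
  shows "\<exists>\<psi> :: 'p::prime_card padic \<Rightarrow> 'p padic^2 \<Rightarrow> 'p padic^2.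
    analytic_symplectic_action padic_int_plane dx_dy \<psi> \<and>
    free_action padic_int_plane \<psi> \<and>
    \<not> proper_action padic_int_plane \<psi> \<and>
    \<not> hamiltonian_action padic_int_plane dx_dy \<psi>"
proof (intro exI conjI)
  show "free_action padic_int_plane baker_action"
    using baker_action_free baker_action_0 by (auto simp: free_action_def stabilizer_def)
qed (rule baker_action_symplectic baker_action_not_proper baker_action_not_hamiltonian)+

end
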